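(* Let $M$ be a closed surface with a triangulation $\mathcal{T}=\{V,E,F\}$ and let $I:E\rightarrow(-1,+\infty)$ be an inversive distance satisfying $$I_{ij}+I_{ik}I_{jk}\geq 0,\quad I_{ik}+I_{ij}I_{jk}\geq 0,\quad I_{jk}+I_{ij}I_{ik}\geq 0$$ for every triangle $\triangle ijk\in F$. Let $\alpha\in\mathbb{R}$ and let $\overline{R}:V\to\mathbb{R}$ be a given function. Then: (1) If $\alpha\overline{R}\equiv 0$, there exists at most one Euclidean inversive distance circle packing metric with combinatorial $\alpha$-curvature $\overline{R}$ up to scaling (i.e. up to multiplication of $r$ by a positive constant). If $\alpha\overline{R}\leq 0$ and $\alpha\overline{R}\not\equiv 0$, there exists at most one Euclidean inversive distance circle packing metric with combinatorial $\alpha$-curvature $\overline{R}$. (2) If $\alpha\overline{R}\leq 0$, there exists at most one hyperbolic inversive distance circle packing metric with combinatorial $\alpha$-curvature $\overline{R}$.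
   Context: $M$ is a closed surface (connected, as usual) with a triangulation $\mathcal{T}=\{V,E,F\}$, where $V,E,F$ are the sets of vertices, edges and faces; the vertices are $1,\dots,N$. $I_{ij}$ denotes the value of $I:E\to(-1,+\infty)$ on the edge $\{ij\}$. For $r:V\to(0,+\infty)$, each edge $\{ij\}$ is assigned the length $$l_{ij}=\sqrt{r_i^2+r_j^2+2r_ir_jI_{ij}}$$ in the Euclidean background geometry, and $$l_{ij}=\cosh^{-1}\big(\cosh r_i\cosh r_j+I_{ij}\sinh r_i\sinh r_j\big)$$ in the hyperbolic background geometry. The function $r$ is called a (Euclidean, resp. hyperbolic) inversive distance circle packing metric if for every face $\triangle ijk\in F$ the three lengths $l_{ij},l_{ik},l_{jk}$ satisfy the strict triangle inequalities. In this case each face is realized as a Euclidean (resp. hyperbolic) triangle with these edge lengths; let $\theta_i^{jk}$ denote its inner angle at the vertex $i$. The classical combinatorial curvature is $K_i=2\pi-\sum_{\triangle ijk\in F}\theta_i^{jk}$, the sum being over all faces having $i$ as a vertex. For $\alpha\in\mathbb{R}$, the combinatorial $\alpha$-curvature of $r$ is the function $R_\alpha:V\to\mathbb{R}$, $$R_{\alpha,i}=\frac{K_i}{s_i^\alpha},$$ where $s_i=r_i$ in the Euclidean background geometry and $s_i=\tanh\frac{r_i}{2}$ in the hyperbolic background geometry. The inequality $\alpha\overline{R}\le 0$ means $\alpha\overline{R}_i\leq 0$ for every vertex $i$, and $\alpha\overline R\equiv 0$ means $\alpha\overline R_i=0$ for every $i$. *)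

theory Defs
  imports "HOL-Analysis.Analysis"
begin

section \<open>Triangulated closed surfaces\<close>

definition closed_surface :: "'m topology \<Rightarrow> bool" where
  "closed_surface M \<longleftrightarrow>
     topspace M \<noteq> {} \<and> connected_space M \<and> compact_space M \<and> Hausdorff_space M \<and>
     (\<forall>p \<in> topspace M. \<exists>U. openin M U \<and> p \<in> U \<and>
        (\<exists>W :: (real^2) set. open W \<and> subtopology M U homeomorphic_space top_of_set W))"

text \<open>Points are given by their barycentric coordinates; the simplices are the nonempty
  subsets of the members of \<open>F\<close>. For finite \<open>V\<close> this is the usual topology.\<close>

definition geometric_realization :: "'v set \<Rightarrow> 'v set set \<Rightarrow> ('v \<Rightarrow> real) topology" where
  "geometric_realization V F =
     subtopology (powertop_real V)
       {x. (\<forall>v\<in>V. 0 \<le> x v) \<and> (\<Sum>v\<in>V. x v) = 1 \<and> (\<exists>f\<in>F. {v\<in>V. x v \<noteq> 0} \<subseteq> f)}"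

text \<open>Edges and faces are identified with their sets of vertices. The triangles cover the
  surface, so the vertices and edges are precisely those of the triangles.\<close>

definition surface_triangulation ::
    "'m topology \<Rightarrow> 'v set \<Rightarrow> 'v set set \<Rightarrow> 'v set set \<Rightarrow> bool" where
  "surface_triangulation M V E F \<longleftrightarrow>
     finite F \<and> (\<forall>f\<in>F. card f = 3) \<and>
     V = \<Union>F \<and> E = {e. card e = 2 \<and> (\<exists>f\<in>F. e \<subseteq> f)} \<and>
     geometric_realization V F homeomorphic_space M"


section \<open>Angles in the Euclidean and the hyperbolic plane\<close>

definition euclidean_angle :: "real^2 \<Rightarrow> real^2 \<Rightarrow> real^2 \<Rightarrow> real" where
  "euclidean_angle A B C =
     arccos (((B - A) \<bullet> (C - A)) / (norm (B - A) * norm (C - A)))"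

text \<open>The hyperbolic plane of curvature \<open>-1\<close> is the upper sheet of the hyperboloid in
  Minkowski space, with the first coordinate as the time coordinate.\<close>

definition lorentz :: "real \<times> (real^2) \<Rightarrow> real \<times> (real^2) \<Rightarrow> real" where
  "lorentz p q = snd p \<bullet> snd q - fst p * fst q"

definition hyperbolic_plane :: "(real \<times> (real^2)) set" where
  "hyperbolic_plane = {p. lorentz p p = -1 \<and> fst p > 0}"

definition hyperbolic_dist :: "real \<times> (real^2) \<Rightarrow> real \<times> (real^2) \<Rightarrow> real" where
  "hyperbolic_dist p q = arcosh (- lorentz p q)"

text \<open>The orthogonal projection of \<open>q\<close> to the tangent plane at \<open>p\<close>; it is a positive multiple
  of the initial velocity of the geodesic from \<open>p\<close> to \<open>q\<close>.\<close>

definition hyperbolic_direction ::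
    "real \<times> (real^2) \<Rightarrow> real \<times> (real^2) \<Rightarrow> real \<times> (real^2)" where
  "hyperbolic_direction p q = q + lorentz p q *\<^sub>R p"

definition hyperbolic_angle ::
    "real \<times> (real^2) \<Rightarrow> real \<times> (real^2) \<Rightarrow> real \<times> (real^2) \<Rightarrow> real" where
  "hyperbolic_angle A B C =
     (let u = hyperbolic_direction A B; v = hyperbolic_direction A C
      in arccos (lorentz u v / (sqrt (lorentz u u) * sqrt (lorentz v v))))"

text \<open>The inner angle at the vertex \<open>i\<close> of the face \<open>f\<close>, realized as a geodesic triangle with
  side lengths \<open>l\<close>. It is meaningful if \<open>l\<close> is symmetric and satisfies the strict triangle
  inequalities on \<open>f\<close>; the realization is then unique up to isometry.\<close>

definition euclidean_inner_angle :: "('v \<Rightarrow> 'v \<Rightarrow> real) \<Rightarrow> 'v \<Rightarrow> 'v set \<Rightarrow> real" where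
  "euclidean_inner_angle l i f =
     (THE \<theta>. \<exists>j k A B C. f = {i, j, k} \<and> distinct [i, j, k] \<and>
        dist A B = l i j \<and> dist A C = l i k \<and> dist B C = l j k \<and>
        \<theta> = euclidean_angle A B C)"

definition hyperbolic_inner_angle :: "('v \<Rightarrow> 'v \<Rightarrow> real) \<Rightarrow> 'v \<Rightarrow> 'v set \<Rightarrow> real" where
  "hyperbolic_inner_angle l i f =
     (THE \<theta>. \<exists>j k. f = {i, j, k} \<and> distinct [i, j, k] \<and>
        (\<exists>A \<in> hyperbolic_plane. \<exists>B \<in> hyperbolic_plane. \<exists>C \<in> hyperbolic_plane.
          hyperbolic_dist A B = l i j \<and> hyperbolic_dist A C = l i k \<and>
          hyperbolic_dist B C = l j k \<and> \<theta> = hyperbolic_angle A B C))"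


section \<open>Inversive distance circle packing metrics\<close>

definition euclidean_length :: "('v set \<Rightarrow> real) \<Rightarrow> ('v \<Rightarrow> real) \<Rightarrow> 'v \<Rightarrow> 'v \<Rightarrow> real" where
  "euclidean_length I r i j = sqrt ((r i)\<^sup>2 + (r j)\<^sup>2 + 2 * r i * r j * I {i, j})"

definition hyperbolic_length :: "('v set \<Rightarrow> real) \<Rightarrow> ('v \<Rightarrow> real) \<Rightarrow> 'v \<Rightarrow> 'v \<Rightarrow> real" where
  "hyperbolic_length I r i j =
     arcosh (cosh (r i) * cosh (r j) + I {i, j} * sinh (r i) * sinh (r j))"

definition strict_triangle_inequalities :: "'v set set \<Rightarrow> ('v \<Rightarrow> 'v \<Rightarrow> real) \<Rightarrow> bool" where
  "strict_triangle_inequalities F l \<longleftrightarrow>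
     (\<forall>i j k. {i, j, k} \<in> F \<longrightarrow>
        l i j < l i k + l j k \<and> l i k < l i j + l j k \<and> l j k < l i j + l i k)"

definition euclidean_packing_metric ::
    "'v set \<Rightarrow> 'v set set \<Rightarrow> ('v set \<Rightarrow> real) \<Rightarrow> ('v \<Rightarrow> real) \<Rightarrow> bool" where
  "euclidean_packing_metric V F I r \<longleftrightarrow>
     (\<forall>i\<in>V. 0 < r i) \<and> strict_triangle_inequalities F (euclidean_length I r)"

definition hyperbolic_packing_metric ::
    "'v set \<Rightarrow> 'v set set \<Rightarrow> ('v set \<Rightarrow> real) \<Rightarrow> ('v \<Rightarrow> real) \<Rightarrow> bool" where
  "hyperbolic_packing_metric V F I r \<longleftrightarrow>
     (\<forall>i\<in>V. 0 < r i) \<and> strict_triangle_inequalities F (hyperbolic_length I r)"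


section \<open>Combinatorial curvatures\<close>

definition euclidean_curvature ::
    "'v set set \<Rightarrow> ('v set \<Rightarrow> real) \<Rightarrow> ('v \<Rightarrow> real) \<Rightarrow> 'v \<Rightarrow> real" where
  "euclidean_curvature F I r i =
     2 * pi - (\<Sum>f | f \<in> F \<and> i \<in> f. euclidean_inner_angle (euclidean_length I r) i f)"

definition hyperbolic_curvature ::
    "'v set set \<Rightarrow> ('v set \<Rightarrow> real) \<Rightarrow> ('v \<Rightarrow> real) \<Rightarrow> 'v \<Rightarrow> real" where
  "hyperbolic_curvature F I r i =
     2 * pi - (\<Sum>f | f \<in> F \<and> i \<in> f. hyperbolic_inner_angle (hyperbolic_length I r) i f)"

definition euclidean_alpha_curvature ::
    "'v set set \<Rightarrow> ('v set \<Rightarrow> real) \<Rightarrow> real \<Rightarrow> ('v \<Rightarrow> real) \<Rightarrow> 'v \<Rightarrow> real" where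
  "euclidean_alpha_curvature F I \<alpha> r i = euclidean_curvature F I r i / r i powr \<alpha>"

definition hyperbolic_alpha_curvature ::
    "'v set set \<Rightarrow> ('v set \<Rightarrow> real) \<Rightarrow> real \<Rightarrow> ('v \<Rightarrow> real) \<Rightarrow> 'v \<Rightarrow> real" where
  "hyperbolic_alpha_curvature F I \<alpha> r i =
     hyperbolic_curvature F I r i / tanh (r i / 2) powr \<alpha>"

end

theory Submission
  imports Defs
begin

text \<open>Write \<open>u\<^sub>i = ln r\<^sub>i\<close> in the Euclidean and \<open>u\<^sub>i = ln (tanh (r\<^sub>i / 2))\<close> in the hyperbolic background geometry, so that
\<open>s\<^sub>i = exp u\<^sub>i\<close> in both. Everything rests on one inequality for a single face: if two packing
metrics \<open>u\<close>, \<open>u'\<close> give a face the angles \<open>\<theta>\<^sub>i\<close>, \<open>\<theta>'\<^sub>i\<close>, then the sum of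
\<open>(u'\<^sub>i - u\<^sub>i) (\<theta>'\<^sub>i - \<theta>\<^sub>i)\<close> over its three vertices is at most 0, and it vanishes only if \<open>u' - u\<close> is
constant on the face (Euclidean), respectively zero there (hyperbolic). Summed over all faces this
bounds the sum of \<open>(u'\<^sub>i - u\<^sub>i) (K'\<^sub>i - K\<^sub>i)\<close> over the vertices below by 0. Equal \<open>\<alpha>\<close>-curvatures mean
\<open>K\<^sub>i = R\<^sub>i exp (\<alpha> u\<^sub>i)\<close>, and \<open>\<alpha> R\<^sub>i \<le> 0\<close> makes each of those vertex terms at most 0. Hence every face term
and every vertex term vanishes (\<open>equality_in_curvature_comparison\<close>). In the hyperbolic case this
is \<open>r' = r\<close>. In the Euclidean case \<open>u' - u\<close> is constant on faces, hence constant because the surface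
is connected (\<open>constant_on_faces_imp_constant\<close>), and a vertex with \<open>\<alpha> R\<^sub>i \<noteq> 0\<close> forces the constant
to be 0.

For the inequality on a face, move along the segment from \<open>u\<close> to \<open>u'\<close>. It may leave the set of
radii for which the three lengths form a triangle. There the cosine law returns a number of
absolute value at least 1 at all three vertices simultaneously; clamping this number to \<open>[-1, 1]\<close>
extends the angles continuously, with values in \<open>{0, \<pi>}\<close> at the degenerate radii. Along the
segment the weighted sum \<open>g = \<Sum> (u'\<^sub>i - u\<^sub>i) \<theta>\<^sub>i\<close> is therefore continuous, it takes only finitely many
values at the degenerate times, and at all other times it has negative derivative. Such a function
satisfies \<open>g 1 < g 0\<close> (\<open>strict_decrease_off_finite_values\<close>).

The derivative of \<open>g\<close> is minus a quadratic form in \<open>u' - u\<close>, divided by the positive square root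
of a discriminant. Its coefficients are, up to positive factors, the barycentric coordinates of the
radical center of the three circles. The sign conditions on the inversive distances enter twice. They
force at least two of these coordinates to be positive (\<open>two_radical_coordinates_pos\<close>), and they
make a sum of two cyclic products positive (\<open>cyclic_products_pos\<close>), which is the only factor of the
determinant of the form whose sign is in doubt. In the Euclidean case, where constants are in the
kernel, these two facts give definiteness modulo constants. In the hyperbolic case
they suffice if the third coordinate is nonnegative. If it is negative, there are two vectors,
orthogonal with respect to the form, on which the form is positive; together with a positive
determinant this yields definiteness.\<close>

section \<open>Functions that decrease off a finite set of values\<close>

text \<open>A function that fails to decrease would, after an initial drop, have to climb back through
  an interval of values. This interval contains a value outside \<open>Z\<close>, and such a value cannot be
  crossed from below to above.\<close>

lemma strict_decrease_off_finite_values: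
  fixes g :: "real \<Rightarrow> real"
  assumes cont: "continuous_on {0..1} g" and fin: "finite Z"
    and deriv: "\<And>t. 0 \<le> t \<Longrightarrow> t < 1 \<Longrightarrow> g t \<notin> Z \<Longrightarrow> \<exists>D<0. (g has_real_derivative D) (at t)"
    and start: "(g has_real_derivative D0) (at 0)" "D0 < 0"
  shows "g 1 < g 0"
proof (rule ccontr)
  assume "\<not> g 1 < g 0"
  obtain d where d: "d > 0" "\<And>h. 0 < h \<Longrightarrow> h < d \<Longrightarrow> g (0 + h) < g 0"
    using DERIV_neg_dec_right[OF start] by blast
  define t0 where "t0 = min (d/2) (1/2)"
  have t0: "0 < t0" "t0 < 1" and "t0 < d" unfolding t0_def using d by (auto simp: min_def)
  then have t0g: "g t0 < g 1" using \<open>\<not> g 1 < g 0\<close> d(2)[of t0] by auto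
  have "infinite ({g t0<..<g 1} - Z)"
    using t0g fin by (simp add: infinite_Ioo)
  then obtain y where y: "g t0 < y" "y < g 1" "y \<notin> Z"
    by (metis Diff_iff ex_in_conv finite.emptyI greaterThanLessThan_iff)
  \<comment> \<open>The maximum of \<open>S\<close> is the last time at which \<open>g\<close> does not exceed \<open>y\<close>. There \<open>g\<close> equals \<open>y\<close>, which is
      not an exceptional value, so \<open>g\<close> drops below \<open>y\<close> immediately afterwards.\<close>
  define S where "S = {t \<in> {t0..1}. g t \<in> {..y}}"
  have cont': "continuous_on {t0..1} g"
    using cont by (rule continuous_on_subset) (use t0 in auto)
  have "closed S"
    unfolding S_def using continuous_closed_preimage[OF cont', of "{..y}"]
    by (simp add: vimage_def Int_def Collect_conj_eq[symmetric])
  moreover have "bounded S"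
    unfolding S_def by (rule bounded_subset[of "{t0..1}"]) auto
  moreover have "t0 \<in> S" unfolding S_def using y t0 by auto
  ultimately obtain s where s: "s \<in> S" "\<And>t. t \<in> S \<Longrightarrow> t \<le> s"
    using compact_attains_sup[of S] by (auto simp: compact_eq_bounded_closed)
  have s01: "t0 \<le> s" "s < 1" "g s \<le> y"
    using s(1) y(2) unfolding S_def by (auto simp: less_le)
  have "g s = y"
  proof (rule ccontr)
    assume "g s \<noteq> y"
    obtain t where "s \<le> t" "t \<le> 1" "g t = y"
      using IVT'[of g s y 1] s01 y(2) continuous_on_subset[OF cont', of "{s..1}"] by auto
    with s(2)[of t] s01 \<open>g s \<noteq> y\<close> show False unfolding S_def by auto
  qed
  then obtain D where D: "D < 0" "(g has_real_derivative D) (at s)"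
    using deriv[of s] s01 t0 y(3) by auto
  obtain e where e: "e > 0" "\<And>h. 0 < h \<Longrightarrow> h < e \<Longrightarrow> g (s + h) < g s"
    using DERIV_neg_dec_right[OF D(2,1)] by blast
  define h where "h = min (e/2) (1 - s)"
  have "0 < h" "h < e" "s + h \<le> 1" unfolding h_def using e s01 by auto
  then have "s + h \<in> S"
    using e(2)[of h] \<open>g s = y\<close> s01 unfolding S_def by auto
  with s(2) \<open>0 < h\<close> show False by force
qed

section \<open>Angles given by a clamped arc cosine\<close>

text \<open>Applied to the cosine law, the clamping is the continuous extension of the angles by \<open>\<pi>\<close> and 0
  to lengths that violate a triangle inequality.\<close>

definition clamped_arccos :: "real \<Rightarrow> real" where
  "clamped_arccos x = arccos (max (-1) (min 1 x))"

lemma continuous_on_clamped_arccos [continuous_intros]: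
  assumes "continuous_on S f" shows "continuous_on S (\<lambda>t. clamped_arccos (f t))"
  unfolding clamped_arccos_def by (intro continuous_intros assms) auto

lemma clamped_arccos_eq: "\<bar>x\<bar> \<le> 1 \<Longrightarrow> clamped_arccos x = arccos x"
  unfolding clamped_arccos_def by (auto simp: max_def min_def)

lemma clamped_arccos_degenerate: "1 \<le> \<bar>x\<bar> \<Longrightarrow> clamped_arccos x \<in> {0, pi}"
  unfolding clamped_arccos_def by (auto simp: abs_if max_def min_def split: if_splits)

text \<open>All cosine laws below have the form \<open>n / sqrt s\<close>, so that \<open>s - n\<^sup>2\<close> decides whether the
  quotient is the cosine of a genuine angle.\<close>

lemma abs_quotient_sqrt_less_1:
  fixes n s :: real
  assumes "s > 0" shows "\<bar>n / sqrt s\<bar> < 1 \<longleftrightarrow> n\<^sup>2 < s"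
proof -
  have "\<bar>n / sqrt s\<bar> < 1 \<longleftrightarrow> \<bar>n\<bar> < sqrt s" using assms by (simp add: abs_divide)
  also have "\<dots> \<longleftrightarrow> n\<^sup>2 < s" by (metis real_sqrt_abs real_sqrt_less_iff)
  finally show ?thesis .
qed

lemma clamped_arccos_quotient_deriv:
  fixes N \<sigma> :: "real \<Rightarrow> real"
  assumes dN: "(N has_real_derivative N') (at t)" and ds: "(\<sigma> has_real_derivative \<sigma>') (at t)"
    and pos: "\<sigma> t > 0" and nondeg: "\<sigma> t - (N t)\<^sup>2 = \<Delta>" "\<Delta> > 0"
  shows "((\<lambda>t. clamped_arccos (N t / sqrt (\<sigma> t))) has_real_derivative
            - ((N' - N t * \<sigma>' / (2 * \<sigma> t)) / sqrt \<Delta>)) (at t)"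
proof -
  define f where "f = (\<lambda>t. N t / sqrt (\<sigma> t))"
  define R where "R = sqrt (\<sigma> t)"
  have R: "R > 0" "R * R = \<sigma> t" using pos by (auto simp: R_def)
  have f1: "\<bar>f t\<bar> < 1"
    unfolding f_def using abs_quotient_sqrt_less_1[OF pos, of "N t"] nondeg by simp
  have df: "(f has_real_derivative ((N' - N t * \<sigma>' / (2 * \<sigma> t)) / R)) (at t)"
  proof -
    have "(f has_real_derivative (N' * sqrt (\<sigma> t) - N t * (\<sigma>' * inverse (sqrt (\<sigma> t)) / 2)) / (sqrt (\<sigma>
        t) * sqrt (\<sigma> t))) (at t)"
      unfolding f_def using pos
      by (auto intro!: derivative_eq_intros dN ds simp: field_simps)
    moreover have "(N' * R - N t * (\<sigma>' * inverse R / 2)) / (R * R) = (N' - N t * \<sigma>' / (2 * \<sigma> t)) / R"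
      using R(1) by (simp add: R(2)[symmetric] field_simps)
    ultimately show ?thesis unfolding R_def by simp
  qed
  have "1 - (f t)\<^sup>2 = \<Delta> / \<sigma> t"
    using pos nondeg by (simp add: f_def power_divide field_simps)
  then have sq: "sqrt (1 - (f t)\<^sup>2) = sqrt \<Delta> / R"
    by (simp add: R_def real_sqrt_divide)
  have "((\<lambda>t. arccos (f t)) has_real_derivative
          inverse (- sqrt (1 - (f t)\<^sup>2)) * ((N' - N t * \<sigma>' / (2 * \<sigma> t)) / R)) (at t)"
    using f1 by (intro DERIV_chain2[of arccos, OF DERIV_arccos] df) auto
  also have "inverse (- sqrt (1 - (f t)\<^sup>2)) * ((N' - N t * \<sigma>' / (2 * \<sigma> t)) / R) =
      - ((N' - N t * \<sigma>' / (2 * \<sigma> t)) / sqrt \<Delta>)"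
    unfolding sq using R(1) nondeg(2) by (simp add: field_simps)
  finally have main: "((\<lambda>t. arccos (f t)) has_real_derivative - ((N' - N t * \<sigma>' / (2 * \<sigma> t)) / sqrt \<Delta>))
      (at t)" .
  have "isCont (\<lambda>t. \<bar>f t\<bar>) t"
    using DERIV_isCont[OF df] by (intro continuous_intros)
  then have "\<forall>\<^sub>F s in at t. \<bar>f s\<bar> < 1"
    using f1 by (auto simp: isCont_def intro: order_tendstoD)
  then have "\<forall>\<^sub>F s in nhds t. arccos (f s) = clamped_arccos (f s)"
    using f1 unfolding eventually_at_filter
    by (elim eventually_mono) (metis UNIV_I clamped_arccos_eq less_imp_le)
  then show ?thesis
    using main by (subst DERIV_cong_ev[OF refl _ refl, symmetric]) (auto simp: f_def)
qed

text \<open>The three angles of a triangle share the discriminant \<open>\<Delta> = s - N\<^sup>2\<close>, so they degenerate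
  simultaneously and the clamped angle sum then takes one of finitely many values. Where \<open>\<Delta> > 0\<close>
  the derivative is \<open>- 1 / sqrt \<Delta>\<close> times the expression in the assumption \<open>form\<close>.\<close>

lemma weighted_angle_sum_decreases:
  fixes N1 N2 N3 s1 s2 s3 \<Delta> :: "real \<Rightarrow> real"
  assumes dN1: "\<And>t. t \<in> {0..1} \<Longrightarrow> (N1 has_real_derivative N1' t) (at t)"
    and dN2: "\<And>t. t \<in> {0..1} \<Longrightarrow> (N2 has_real_derivative N2' t) (at t)"
    and dN3: "\<And>t. t \<in> {0..1} \<Longrightarrow> (N3 has_real_derivative N3' t) (at t)"
    and ds1: "\<And>t. t \<in> {0..1} \<Longrightarrow> (s1 has_real_derivative s1' t) (at t)"
    and ds2: "\<And>t. t \<in> {0..1} \<Longrightarrow> (s2 has_real_derivative s2' t) (at t)"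
    and ds3: "\<And>t. t \<in> {0..1} \<Longrightarrow> (s3 has_real_derivative s3' t) (at t)"
    and pos: "\<And>t. t \<in> {0..1} \<Longrightarrow> s1 t > 0 \<and> s2 t > 0 \<and> s3 t > 0"
    and disc: "\<And>t. t \<in> {0..1} \<Longrightarrow> s1 t - (N1 t)\<^sup>2 = \<Delta> t \<and> s2 t - (N2 t)\<^sup>2 = \<Delta> t \<and> s3 t - (N3 t)\<^sup>2 = \<Delta> t"
    and form: "\<And>t. t \<in> {0..1} \<Longrightarrow> \<Delta> t > 0 \<Longrightarrow>
       x1 * (N1' t - N1 t * s1' t / (2 * s1 t)) + x2 * (N2' t - N2 t * s2' t / (2 * s2 t))
       + x3 * (N3' t - N3 t * s3' t / (2 * s3 t)) > 0"
    and start: "\<Delta> 0 > 0"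
  defines "g \<equiv> \<lambda>t. x1 * clamped_arccos (N1 t / sqrt (s1 t)) + x2 * clamped_arccos (N2 t / sqrt (s2 t))
                 + x3 * clamped_arccos (N3 t / sqrt (s3 t))"
  shows "g 1 < g 0"
proof -
  \<comment> \<open>the eight values of \<open>g\<close> that degenerate angles can produce\<close>
  define Z where "Z = (\<lambda>(a, b, c). x1 * a + x2 * b + x3 * c) ` ({0, pi} \<times> {0, pi} \<times> {0, pi})"
  have "finite Z" unfolding Z_def by simp
  have contN: "continuous_on {0..1} N1" "continuous_on {0..1} N2" "continuous_on {0..1} N3"
    and conts: "continuous_on {0..1} s1" "continuous_on {0..1} s2" "continuous_on {0..1} s3"
    by (blast intro: continuous_at_imp_continuous_on DERIV_isCont dN1 dN2 dN3 ds1 ds2 ds3)+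
  have "continuous_on {0..1} g"
    unfolding g_def using pos by (intro continuous_intros contN conts) force+
  moreover have deriv: "\<exists>D<0. (g has_real_derivative D) (at t)" if t: "t \<in> {0..1}" and "\<Delta> t > 0" for t
  proof -
    let ?q1 = "N1' t - N1 t * s1' t / (2 * s1 t)" and ?q2 = "N2' t - N2 t * s2' t / (2 * s2 t)"
      and ?q3 = "N3' t - N3 t * s3' t / (2 * s3 t)"
    have "(g has_real_derivative x1 * - (?q1 / sqrt (\<Delta> t)) + x2 * - (?q2 / sqrt (\<Delta> t))
        + x3 * - (?q3 / sqrt (\<Delta> t))) (at t)"
      unfolding g_def using pos[OF t] disc[OF t] \<open>\<Delta> t > 0\<close>
      by (intro DERIV_add DERIV_cmult clamped_arccos_quotient_deriv dN1 dN2 dN3 ds1 ds2 ds3 t) auto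
    also have "x1 * - (?q1 / sqrt (\<Delta> t)) + x2 * - (?q2 / sqrt (\<Delta> t)) + x3 * - (?q3 / sqrt (\<Delta> t))
       = - ((x1 * ?q1 + x2 * ?q2 + x3 * ?q3) / sqrt (\<Delta> t))"
      by (simp add: add_divide_distrib)
    finally show ?thesis using form[OF t \<open>\<Delta> t > 0\<close>] \<open>\<Delta> t > 0\<close>
      by (intro exI[of _ "- ((x1 * ?q1 + x2 * ?q2 + x3 * ?q3) / sqrt (\<Delta> t))"]) auto
  qed
  moreover have "g t \<in> Z" if t: "t \<in> {0..1}" and "\<not> \<Delta> t > 0" for t
  proof -
    have "clamped_arccos (N1 t / sqrt (s1 t)) \<in> {0, pi}" "clamped_arccos (N2 t / sqrt (s2 t)) \<in> {0, pi}"
      "clamped_arccos (N3 t / sqrt (s3 t)) \<in> {0, pi}"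
      using pos[OF t] disc[OF t] \<open>\<not> \<Delta> t > 0\<close> abs_quotient_sqrt_less_1
      by (auto intro!: clamped_arccos_degenerate simp: not_less[symmetric] simp del: insert_iff)
    then show ?thesis unfolding g_def Z_def by (auto simp: image_iff)
  qed
  ultimately have "\<exists>D<0. (g has_real_derivative D) (at t)" if "0 \<le> t" "t < 1" "g t \<notin> Z" for t
    using that by (metis atLeastAtMost_iff less_imp_le)
  moreover obtain D0 where "D0 < 0" "(g has_real_derivative D0) (at 0)"
    using deriv[of 0] start by auto
  ultimately show ?thesis
    using strict_decrease_off_finite_values[OF \<open>continuous_on {0..1} g\<close> \<open>finite Z\<close>] by blast
qed

section \<open>Three circles with given inversive distances\<close>

text \<open>\<open>I1\<close>, \<open>I2\<close>, \<open>I3\<close> are the inversive distances on the edges opposite the vertices 1, 2, 3.\<close>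

definition compatible_weights :: "real \<Rightarrow> real \<Rightarrow> real \<Rightarrow> bool" where
  "compatible_weights I1 I2 I3 \<longleftrightarrow> -1 < I1 \<and> -1 < I2 \<and> -1 < I3 \<and>
     0 \<le> I1 + I2 * I3 \<and> 0 \<le> I2 + I1 * I3 \<and> 0 \<le> I3 + I1 * I2"

text \<open>For \<open>ki = 1 / ri\<close> in the Euclidean plane and \<open>ki = coth ri\<close> in the hyperbolic plane this has the
  sign of the first barycentric coordinate of the radical center of the circles, provided that the
  vertices form a nondegenerate triangle. It is the first entry of
  \<open>adj G\<close> applied to \<open>(k1, k2, k3)\<close>, where \<open>G\<close> has diagonal 1 and off-diagonal entries \<open>- Ii\<close>.\<close>

definition radical_coordinate :: "real \<Rightarrow> real \<Rightarrow> real \<Rightarrow> real \<Rightarrow> real \<Rightarrow> real \<Rightarrow> real" where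
  "radical_coordinate I1 I2 I3 k1 k2 k3 = k1 * (1 - I1\<^sup>2) + k2 * (I3 + I1 * I2) + k3 * (I2 + I1 * I3)"

lemma compatible_weights_swap:
  assumes "compatible_weights I1 I2 I3"
  shows "compatible_weights I2 I1 I3" "compatible_weights I1 I3 I2"
  using assms unfolding compatible_weights_def by (auto simp: algebra_simps)

lemma weight_gt_1_if_radical_coordinate_neg:
  assumes "compatible_weights I1 I2 I3" "k1 > 0" "k2 > 0" "k3 > 0" "radical_coordinate I1 I2 I3 k1 k2 k3 < 0"
  shows "I1 > 1"
proof (rule ccontr)
  assume "\<not> I1 > 1"
  with assms(1) have "\<bar>I1\<bar> \<le> 1" unfolding compatible_weights_def by auto
  then have "I1\<^sup>2 \<le> 1" by (simp add: abs_square_le_1)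
  then have "0 \<le> k1 * (1 - I1\<^sup>2)" "0 \<le> k2 * (I3 + I1 * I2)" "0 \<le> k3 * (I2 + I1 * I3)"
    using assms unfolding compatible_weights_def by auto
  with assms(5) show False unfolding radical_coordinate_def by linarith
qed

text \<open>If both are nonpositive, then \<open>I1, I2 \<ge> 1\<close>, and multiplying the two inequalities gives
  \<open>\<gamma>\<^sup>2 \<le> (I1\<^sup>2 - 1) (I2\<^sup>2 - 1) \<le> (I1 I2 - 1)\<^sup>2\<close> for \<open>\<gamma> = I3 + I1 I2\<close>. This contradicts
  \<open>\<gamma> > I1 I2 - 1 \<ge> 0\<close>, which is the condition \<open>I3 > -1\<close>.\<close>

lemma radical_coordinates_not_both_nonpos:
  assumes adm: "compatible_weights I1 I2 I3" and k: "k1 > 0" "k2 > 0" "k3 > 0"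
    and h1: "radical_coordinate I1 I2 I3 k1 k2 k3 \<le> 0" and h2: "radical_coordinate I2 I1 I3 k2 k1 k3 \<le> 0"
  shows False
proof -
  define \<gamma> where "\<gamma> = I3 + I1 * I2"
  have g: "0 \<le> \<gamma>" "0 \<le> I1 + I2 * I3" "0 \<le> I2 + I1 * I3" and I: "-1 < I1" "-1 < I2" "-1 < I3"
    using adm unfolding compatible_weights_def \<gamma>_def by auto
  have 1: "k2 * \<gamma> \<le> k1 * (I1\<^sup>2 - 1)"
    using h1 mult_nonneg_nonneg[OF less_imp_le[OF k(3)] g(3)] unfolding radical_coordinate_def \<gamma>_def
    by (simp add: algebra_simps)
  have 2: "k1 * \<gamma> \<le> k2 * (I2\<^sup>2 - 1)"
    using h2 mult_nonneg_nonneg[OF less_imp_le[OF k(3)] g(2)] unfolding radical_coordinate_def \<gamma>_def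
    by (simp add: algebra_simps)
  have "0 \<le> k1 * (I1\<^sup>2 - 1)" "0 \<le> k2 * (I2\<^sup>2 - 1)"
    using 1 2 k g(1) by (meson less_imp_le mult_nonneg_nonneg order_trans)+
  then have "1 \<le> I1\<^sup>2" "1 \<le> I2\<^sup>2" using k by (auto simp: zero_le_mult_iff)
  then have I1: "1 \<le> I1" "1 \<le> I2"
    using I abs_square_less_1[of I1] abs_square_less_1[of I2] by linarith+
  have "(k2 * \<gamma>) * (k1 * \<gamma>) \<le> (k1 * (I1\<^sup>2 - 1)) * (k2 * (I2\<^sup>2 - 1))"
    using mult_mono[OF 1 2 \<open>0 \<le> k1 * (I1\<^sup>2 - 1)\<close>] k g(1) by simp
  then have "(k1 * k2) * \<gamma>\<^sup>2 \<le> (k1 * k2) * ((I1\<^sup>2 - 1) * (I2\<^sup>2 - 1))"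
    by (simp add: algebra_simps power2_eq_square)
  then have "\<gamma>\<^sup>2 \<le> (I1\<^sup>2 - 1) * (I2\<^sup>2 - 1)" using k by (simp add: mult_le_cancel_left)
  also have "\<dots> = (I1 * I2 - 1)\<^sup>2 - (I1 - I2)\<^sup>2" by (simp add: algebra_simps power2_eq_square)
  also have "\<dots> \<le> (I1 * I2 - 1)\<^sup>2" by simp
  also have "\<dots> < \<gamma>\<^sup>2"
  proof (rule power_strict_mono)
    show "I1 * I2 - 1 < \<gamma>" unfolding \<gamma>_def using I by simp
    have "1 * 1 \<le> I1 * I2" using I1 by (intro mult_mono) auto
    then show "0 \<le> I1 * I2 - 1" by simp
  qed simp
  finally show False by simp
qed

lemma two_radical_coordinates_pos:
  assumes adm: "compatible_weights I1 I2 I3" and k: "k1 > 0" "k2 > 0" "k3 > 0"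
  defines "h1 \<equiv> radical_coordinate I1 I2 I3 k1 k2 k3" and "h2 \<equiv> radical_coordinate I2 I1 I3 k2 k1 k3"
    and "h3 \<equiv> radical_coordinate I3 I1 I2 k3 k1 k2"
  shows "(h2 > 0 \<and> h3 > 0) \<or> (h1 > 0 \<and> h3 > 0) \<or> (h1 > 0 \<and> h2 > 0)"
proof -
  have sym: "radical_coordinate I1 I3 I2 k1 k3 k2 = h1" "radical_coordinate I2 I3 I1 k2 k3 k1 = h2"
    "radical_coordinate I3 I2 I1 k3 k2 k1 = h3"
    unfolding h1_def h2_def h3_def radical_coordinate_def by (simp_all add: algebra_simps)
  have adm2: "compatible_weights I1 I3 I2" "compatible_weights I2 I3 I1"
    using adm compatible_weights_swap by blast+
  have "\<not> (h1 \<le> 0 \<and> h2 \<le> 0)"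
    using radical_coordinates_not_both_nonpos[OF adm k] unfolding h1_def h2_def by blast
  moreover have "\<not> (h1 \<le> 0 \<and> h3 \<le> 0)"
    using radical_coordinates_not_both_nonpos[OF adm2(1) k(1) k(3) k(2)] unfolding sym(1) h3_def by blast
  moreover have "\<not> (h2 \<le> 0 \<and> h3 \<le> 0)"
    using radical_coordinates_not_both_nonpos[OF adm2(2) k(2) k(3) k(1)] unfolding sym by blast
  ultimately show ?thesis by linarith
qed

text \<open>Expanding, the coefficients \<open>Ii + Ij Ik\<close> multiply \<open>ki (kj\<^sup>2 + kk\<^sup>2)\<close>. After splitting off the
  squares \<open>(kj - kk)\<^sup>2\<close> the rest is \<open>2 k1 k2 k3 (1 + I1) (1 + I2) (1 + I3)\<close>.\<close>

lemma cyclic_products_pos: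
  assumes adm: "compatible_weights I1 I2 I3" and k: "k1 > 0" "k2 > 0" "k3 > 0"
  shows "0 < (k2 + I3 * k1) * (k3 + I1 * k2) * (k1 + I2 * k3)
           + (k1 + I3 * k2) * (k2 + I1 * k3) * (k3 + I2 * k1)"
proof -
  have "(k2 + I3 * k1) * (k3 + I1 * k2) * (k1 + I2 * k3) + (k1 + I3 * k2) * (k2 + I1 * k3) * (k3 + I2 * k1)
     = 2 * k1 * k2 * k3 * ((1 + I1) * (1 + I2) * (1 + I3)) + k1 * (I1 + I2 * I3) * (k2 - k3)\<^sup>2
       + k2 * (I2 + I1 * I3) * (k1 - k3)\<^sup>2 + k3 * (I3 + I1 * I2) * (k1 - k2)\<^sup>2"
    by (simp add: algebra_simps power2_eq_square)
  moreover have "0 < 2 * k1 * k2 * k3 * ((1 + I1) * (1 + I2) * (1 + I3))"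
    using assms unfolding compatible_weights_def by simp
  moreover have "0 \<le> k1 * (I1 + I2 * I3) * (k2 - k3)\<^sup>2" "0 \<le> k2 * (I2 + I1 * I3) * (k1 - k3)\<^sup>2"
     "0 \<le> k3 * (I3 + I1 * I2) * (k1 - k2)\<^sup>2"
    using assms unfolding compatible_weights_def by simp_all
  ultimately show ?thesis by linarith
qed

section \<open>Variation of the angles of a Euclidean triangle\<close>

text \<open>Heron's expression: sixteen times the squared area of the triangle with the squared side
  lengths \<open>L1\<close>, \<open>L2\<close>, \<open>L3\<close>.\<close>

definition heron :: "real \<Rightarrow> real \<Rightarrow> real \<Rightarrow> real" where
  "heron L1 L2 L3 = 2*L1*L2 + 2*L2*L3 + 2*L3*L1 - L1\<^sup>2 - L2\<^sup>2 - L3\<^sup>2"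

text \<open>With squared lengths \<open>L\<close> and squared radii \<open>q\<close>, where side 1 is opposite vertex 1, this is
  the first barycentric coordinate of the radical center times Heron's expression.\<close>

definition euclidean_weight :: "real \<Rightarrow> real \<Rightarrow> real \<Rightarrow> real \<Rightarrow> real \<Rightarrow> real \<Rightarrow> real" where
  "euclidean_weight L1 L2 L3 q1 q2 q3 = L1*(L2+L3-L1) + q2*(L1+L2-L3) + q3*(L1+L3-L2) - 2*L1*q1"

text \<open>Here \<open>d1\<close>, \<open>d2\<close>, \<open>d3\<close> are the derivatives of the squared lengths when the logarithms of the radii
  move with velocities \<open>x1\<close>, \<open>x2\<close>, \<open>x3\<close>, and the bracket after \<open>xi\<close> is the derivative of the i-th angle
  times the square root of Heron's expression. The form depends only on differences of the
  velocities because scaling preserves angles.\<close>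

lemma euclidean_angle_variation:
  fixes L1 L2 L3 q1 q2 q3 x1 x2 x3 :: real
  assumes "L1 > 0" "L2 > 0" "L3 > 0"
  defines "d1 \<equiv> (L1+q2-q3)*x2+(L1+q3-q2)*x3"
  defines "d2 \<equiv> (L2+q1-q3)*x1+(L2+q3-q1)*x3"
  defines "d3 \<equiv> (L3+q1-q2)*x1+(L3+q2-q1)*x2"
  shows "2 * (x1*(d1 - d2*((L1+L2-L3)/(2*L2)) - d3*((L1+L3-L2)/(2*L3)))
       + x2*(d2 - d1*((L2+L1-L3)/(2*L1)) - d3*((L2+L3-L1)/(2*L3)))
       + x3*(d3 - d1*((L3+L1-L2)/(2*L1)) - d2*((L3+L2-L1)/(2*L2))))
   = - (euclidean_weight L1 L2 L3 q1 q2 q3 / L1 * (x2-x3)^2 + euclidean_weight L2 L1 L3 q2 q1 q3 / L2 *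
       (x1-x3)^2 + euclidean_weight L3 L1 L2 q3 q1 q2 / L3 * (x1-x2)^2)"
  unfolding d1_def d2_def d3_def euclidean_weight_def
  using assms(1-3) by (simp add: field_simps) algebra

text \<open>In barycentric coordinates the left-hand side is positive exactly inside the circumcircle. The
  identity thus reduces the position of the radical center relative to that circle to the sign of the
  two cyclic products on the right.\<close>

lemma euclidean_weight_determinant: 
  fixes L1 L2 L3 q1 q2 q3 :: real
  shows "2 * (euclidean_weight L1 L2 L3 q1 q2 q3 * euclidean_weight L2 L1 L3 q2 q1 q3 * L3
      + euclidean_weight L1 L2 L3 q1 q2 q3 * euclidean_weight L3 L1 L2 q3 q1 q2 * L2
      + euclidean_weight L2 L1 L3 q2 q1 q3 * euclidean_weight L3 L1 L2 q3 q1 q2 * L1)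
   = heron L1 L2 L3 * ((L3+q1-q2)*(L1+q2-q3)*(L2+q3-q1)+(L3+q2-q1)*(L1+q3-q2)*(L2+q1-q3))"
  unfolding euclidean_weight_def heron_def by (simp add: algebra_simps power2_eq_square)

text \<open>\<open>W1 * W2 + W1 * W3 + W2 * W3\<close> is the determinant of the form in the two variables \<open>x1 - x2\<close> and
  \<open>x1 - x3\<close>. A positive determinant and two positive weights exclude a negative definite form.\<close>

lemma difference_form_pos:
  fixes W1 W2 W3 x1 x2 x3 :: real
  assumes W: "W2 > 0" "W3 > 0" and det: "W1 * W2 + W1 * W3 + W2 * W3 > 0" and x: "\<not> (x1 = x2 \<and> x1 = x3)"
  shows "W1 * (x2 - x3)\<^sup>2 + W2 * (x1 - x3)\<^sup>2 + W3 * (x1 - x2)\<^sup>2 > 0"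
proof -
  define a b where "a = x1 - x2" and "b = x1 - x3"
  have "(W1 + W2) * (W2 + W3) = (W1 * W2 + W1 * W3 + W2 * W3) + W2\<^sup>2"
    by (simp add: algebra_simps power2_eq_square)
  then have "(W1 + W2) * (W2 + W3) > 0" using det by (metis add_pos_nonneg zero_le_power2)
  \<comment> \<open>The sum is the coefficient of \<open>b\<^sup>2\<close>, so the square can be completed in \<open>b\<close>.\<close>
  then have pos: "W1 + W2 > 0" using W by (simp add: zero_less_mult_iff)
  have eq: "(W1 + W2) * (W1 * (b - a)\<^sup>2 + W2 * b\<^sup>2 + W3 * a\<^sup>2)
     = ((W1 + W2) * b - W1 * a)\<^sup>2 + (W1 * W2 + W1 * W3 + W2 * W3) * a\<^sup>2"
    by (simp add: algebra_simps power2_eq_square)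
  have "\<dots> > 0"
  proof (cases "a = 0")
    case True
    then have "b \<noteq> 0" using x unfolding a_def b_def by auto
    with True pos show ?thesis by simp
  next
    case False
    with det show ?thesis by (intro add_nonneg_pos) auto
  qed
  with eq have "(W1 + W2) * (W1 * (b - a)\<^sup>2 + W2 * b\<^sup>2 + W3 * a\<^sup>2) > 0" by simp
  then have "W1 * (b - a)\<^sup>2 + W2 * b\<^sup>2 + W3 * a\<^sup>2 > 0" using pos by (simp add: zero_less_mult_iff)
  then show ?thesis by (simp add: a_def b_def)
qed

definition sq_length :: "real \<Rightarrow> real \<Rightarrow> real \<Rightarrow> real" where
  "sq_length I a b = a\<^sup>2 + b\<^sup>2 + 2 * a * b * I"

text \<open>The angle opposite the side with squared length \<open>L1\<close>, extended to degenerate lengths.\<close>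

definition euclidean_corner :: "real \<Rightarrow> real \<Rightarrow> real \<Rightarrow> real" where
  "euclidean_corner L1 L2 L3 = clamped_arccos ((L2 + L3 - L1) / sqrt (4 * L2 * L3))"

lemma sq_length_pos:
  assumes "-1 < I" "0 < a" "0 < b" shows "0 < sq_length I a b"
proof -
  have "sq_length I a b = (a - b)\<^sup>2 + 2 * a * b * (1 + I)"
    unfolding sq_length_def by (simp add: algebra_simps power2_eq_square)
  also have "\<dots> > 0" using assms by (intro add_nonneg_pos) auto
  finally show ?thesis .
qed

lemma sq_length_commute: "sq_length I a b = sq_length I b a"
  unfolding sq_length_def by (simp add: algebra_simps)

lemma euclidean_form_pos:
  assumes adm: "compatible_weights I1 I2 I3" and r: "r1 > 0" "r2 > 0" "r3 > 0"
  defines "L1 \<equiv> sq_length I1 r2 r3" and "L2 \<equiv> sq_length I2 r1 r3" and "L3 \<equiv> sq_length I3 r1 r2"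
    and "q1 \<equiv> r1\<^sup>2" and "q2 \<equiv> r2\<^sup>2" and "q3 \<equiv> r3\<^sup>2"
  assumes heron: "heron L1 L2 L3 > 0" and x: "\<not> (x1 = x2 \<and> x1 = x3)"
  shows "euclidean_weight L1 L2 L3 q1 q2 q3 / L1 * (x2-x3)^2 + euclidean_weight L2 L1 L3 q2 q1 q3 / L2
      * (x1-x3)^2
     + euclidean_weight L3 L1 L2 q3 q1 q2 / L3 * (x1-x2)^2 > 0"
proof -
  have I: "-1 < I1" "-1 < I2" "-1 < I3" using adm unfolding compatible_weights_def by auto
  have L: "L1 > 0" "L2 > 0" "L3 > 0"
    unfolding L1_def L2_def L3_def using I r by (simp_all add: sq_length_pos)
  define w1 w2 w3 where "w1 = euclidean_weight L1 L2 L3 q1 q2 q3" and "w2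
      = euclidean_weight L2 L1 L3 q2 q1 q3" and "w3 = euclidean_weight L3 L1 L2 q3 q1 q2"
  \<comment> \<open>The arguments are the reciprocals of the radii, multiplied by \<open>r1 * r2 * r3\<close>.\<close>
  define h1 h2 h3 where "h1 = radical_coordinate I1 I2 I3 (r2 * r3) (r1 * r3) (r1 * r2)"
    and "h2 = radical_coordinate I2 I1 I3 (r1 * r3) (r2 * r3) (r1 * r2)"
    and "h3 = radical_coordinate I3 I1 I2 (r1 * r2) (r2 * r3) (r1 * r3)"
  have w: "w1 = 4 * (r2 * r3) * h1" "w2 = 4 * (r1 * r3) * h2" "w3 = 4 * (r1 * r2) * h3"
    unfolding w1_def w2_def w3_def h1_def h2_def h3_def L1_def L2_def L3_def q1_def q2_def q3_def
      euclidean_weight_def sq_length_def radical_coordinate_def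
          by (simp_all add: algebra_simps power2_eq_square)
  have "(h2 > 0 \<and> h3 > 0) \<or> (h1 > 0 \<and> h3 > 0) \<or> (h1 > 0 \<and> h2 > 0)"
    unfolding h1_def h2_def h3_def using r by (intro two_radical_coordinates_pos adm) auto
  then have two: "(w2 > 0 \<and> w3 > 0) \<or> (w1 > 0 \<and> w3 > 0) \<or> (w1 > 0 \<and> w2 > 0)"
    unfolding w using r by auto
  define W1 W2 W3 where "W1 = w1 / L1" and "W2 = w2 / L2" and "W3 = w3 / L3"
  have two': "(W2 > 0 \<and> W3 > 0) \<or> (W1 > 0 \<and> W3 > 0) \<or> (W1 > 0 \<and> W2 > 0)"
    unfolding W1_def W2_def W3_def using two L by auto
  have "2 * (w1 * w2 * L3 + w1 * w3 * L2 + w2 * w3 * L1)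
     = heron L1 L2 L3 * ((L3+q1-q2)*(L1+q2-q3)*(L2+q3-q1)+(L3+q2-q1)*(L1+q3-q2)*(L2+q1-q3))"
    unfolding w1_def w2_def w3_def by (rule euclidean_weight_determinant)
  also have "(L3+q1-q2)*(L1+q2-q3)*(L2+q3-q1)+(L3+q2-q1)*(L1+q3-q2)*(L2+q1-q3)
     = 8 * (r1 * r2 * r3) * ((r2 + I3 * r1) * (r3 + I1 * r2) * (r1 + I2 * r3)
           + (r1 + I3 * r2) * (r2 + I1 * r3) * (r3 + I2 * r1))"
  proof -
    have "L3+q1-q2 = 2 * r1 * (r1 + I3 * r2)" "L1+q2-q3 = 2 * r2 * (r2 + I1 * r3)" "L2+q3-q1
        = 2 * r3 * (r3 + I2 * r1)"
      "L3+q2-q1 = 2 * r2 * (r2 + I3 * r1)" "L1+q3-q2 = 2 * r3 * (r3 + I1 * r2)" "L2+q1-q3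
          = 2 * r1 * (r1 + I2 * r3)"
      unfolding L1_def L2_def L3_def q1_def q2_def q3_def sq_length_def
          by (simp_all add: algebra_simps power2_eq_square)
    then show ?thesis by (simp only:) (simp add: algebra_simps)
  qed
  also have "heron L1 L2 L3 * \<dots> > 0"
    using heron cyclic_products_pos[OF adm r] r by simp
  finally have "w1 * w2 * L3 + w1 * w3 * L2 + w2 * w3 * L1 > 0" by simp
  moreover have "w1 * w2 * L3 + w1 * w3 * L2 + w2 * w3 * L1 = (W1 * W2 + W1 * W3 + W2 * W3) * (L1 * L2 * L3)"
    unfolding W1_def W2_def W3_def using L by (simp add: field_simps)
  ultimately have "(W1 * W2 + W1 * W3 + W2 * W3) * (L1 * L2 * L3) > 0" by simp
  then have det: "W1 * W2 + W1 * W3 + W2 * W3 > 0"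
    by (rule zero_less_mult_pos2) (use L in simp)
  have x': "\<not> (x2 = x1 \<and> x2 = x3)" "\<not> (x3 = x2 \<and> x3 = x1)" using x by auto
  from two' have "W1 * (x2-x3)^2 + W2 * (x1-x3)^2 + W3 * (x1-x2)^2 > 0"
  proof (elim disjE conjE)
    assume "W2 > 0" "W3 > 0"
    then show ?thesis using difference_form_pos[of W2 W3 W1 x1 x2 x3] det x by simp
  next
    assume "W1 > 0" "W3 > 0"
    then show ?thesis using difference_form_pos[of W1 W3 W2 x2 x1 x3] det x'
      by (simp add: algebra_simps power2_commute[of x2 x1])
  next
    assume "W1 > 0" "W2 > 0"
    then show ?thesis using difference_form_pos[of W2 W1 W3 x3 x2 x1] det x'
      by (simp add: algebra_simps power2_commute[of x3 x1] power2_commute[of x3 x2] power2_commute[of x2 x1])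
  qed
  then show ?thesis unfolding W1_def W2_def W3_def w1_def w2_def w3_def .
qed

text \<open>The path multiplies the radii by \<open>exp (t * xi)\<close>. It may pass through degenerate
  lengths, where the clamped angles take over.\<close>

lemma euclidean_triangle_strict_monotone:
  fixes r1 r2 r3 r1' r2' r3' I1 I2 I3 :: real
  assumes adm: "compatible_weights I1 I2 I3"
    and r: "r1 > 0" "r2 > 0" "r3 > 0" and r': "r1' > 0" "r2' > 0" "r3' > 0"
  defines "L1 \<equiv> sq_length I1 r2 r3" and "L2 \<equiv> sq_length I2 r1 r3" and "L3 \<equiv> sq_length I3 r1 r2"
    and "L1' \<equiv> sq_length I1 r2' r3'" and "L2' \<equiv> sq_length I2 r1' r3'" and "L3' \<equiv> sq_length I3 r1' r2'"
    and "x1 \<equiv> ln r1' - ln r1" and "x2 \<equiv> ln r2' - ln r2" and "x3 \<equiv> ln r3' - ln r3"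
  assumes heron: "heron L1 L2 L3 > 0" and x: "\<not> (x1 = x2 \<and> x1 = x3)"
  shows "x1 * euclidean_corner L1' L2' L3' + x2 * euclidean_corner L2' L1' L3'
      + x3 * euclidean_corner L3' L1' L2'
       < x1 * euclidean_corner L1 L2 L3 + x2 * euclidean_corner L2 L1 L3 + x3 * euclidean_corner L3 L1 L2"
proof -
  have I: "-1 < I1" "-1 < I2" "-1 < I3" using adm unfolding compatible_weights_def by auto
  define R1 R2 R3 where "R1 = (\<lambda>t. r1 * exp (t * x1))" and "R2 = (\<lambda>t. r2 * exp (t * x2))" and "R3
      = (\<lambda>t. r3 * exp (t * x3))"
  have R: "R1 t > 0" "R2 t > 0" "R3 t > 0" for t unfolding R1_def R2_def R3_def using r by auto
  have R0: "R1 0 = r1" "R2 0 = r2" "R3 0 = r3" unfolding R1_def R2_def R3_def by auto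
  have R1: "R1 1 = r1'" "R2 1 = r2'" "R3 1 = r3'"
    unfolding R1_def R2_def R3_def x1_def x2_def x3_def using r r' by (auto simp: exp_diff)
  have dR: "(R1 has_real_derivative R1 t * x1) (at t)" "(R2 has_real_derivative R2 t * x2) (at t)"
    "(R3 has_real_derivative R3 t * x3) (at t)" for t
    unfolding R1_def R2_def R3_def by (auto intro!: derivative_eq_intros)
  define M1 M2 M3 where "M1 = (\<lambda>t. sq_length I1 (R2 t) (R3 t))" and "M2 = (\<lambda>t. sq_length I2 (R1 t) (R3 t))"
    and "M3 = (\<lambda>t. sq_length I3 (R1 t) (R2 t))"
  have M: "M1 t > 0" "M2 t > 0" "M3 t > 0" for t
    unfolding M1_def M2_def M3_def using R I by (auto intro: sq_length_pos)
  define q1 q2 q3 where "q1 = (\<lambda>t. (R1 t)\<^sup>2)" and "q2 = (\<lambda>t. (R2 t)\<^sup>2)" and "q3 = (\<lambda>t. (R3 t)\<^sup>2)"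
  define d1 d2 d3 where "d1 = (\<lambda>t. (M1 t + q2 t - q3 t) * x2 + (M1 t + q3 t - q2 t) * x3)"
    and "d2 = (\<lambda>t. (M2 t + q1 t - q3 t) * x1 + (M2 t + q3 t - q1 t) * x3)"
    and "d3 = (\<lambda>t. (M3 t + q1 t - q2 t) * x1 + (M3 t + q2 t - q1 t) * x2)"
  have dM: "(M1 has_real_derivative d1 t) (at t)" "(M2 has_real_derivative d2 t) (at t)"
    "(M3 has_real_derivative d3 t) (at t)" for t
    unfolding M1_def M2_def M3_def d1_def d2_def d3_def q1_def q2_def q3_def sq_length_def
    by (auto intro!: derivative_eq_intros dR simp: algebra_simps power2_eq_square)
  have pos: "x1 * ((d2 t + d3 t - d1 t) - (M2 t + M3 t - M1 t) * (4 * (d2 t * M3 t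
      + M2 t * d3 t)) / (2 * (4 * M2 t * M3 t)))
       + x2 * ((d1 t + d3 t - d2 t) - (M1 t + M3 t - M2 t) * (4 * (d1 t * M3 t
           + M1 t * d3 t)) / (2 * (4 * M1 t * M3 t)))
       + x3 * ((d1 t + d2 t - d3 t) - (M1 t + M2 t - M3 t) * (4 * (d1 t * M2 t
           + M1 t * d2 t)) / (2 * (4 * M1 t * M2 t))) > 0"
    if "heron (M1 t) (M2 t) (M3 t) > 0" for t
  proof -
    have coeff: "(c + d - b) - (C + D - B) * (4 * (c * D + C * d)) / (2 * (4 * C * D))
        = - (b - c * ((B + C - D) / (2 * C)) - d * ((B + D - C) / (2 * D)))" if "C > 0"
            "D > 0" for b c d B C D :: real
      using that by (simp add: field_simps)
    have "0 < euclidean_weight (M1 t) (M2 t) (M3 t) (q1 t) (q2 t) (q3 t) / M1 t * (x2-x3)^2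
        + euclidean_weight (M2 t) (M1 t) (M3 t) (q2 t) (q1 t) (q3 t) / M2 t * (x1-x3)^2
     + euclidean_weight (M3 t) (M1 t) (M2 t) (q3 t) (q1 t) (q2 t) / M3 t * (x1-x2)^2"
      using euclidean_form_pos[OF adm R[of t] _ x] that unfolding M1_def M2_def M3_def q1_def q2_def
          q3_def by simp
    have halve: "0 < - (2 * (a + b + c)) \<Longrightarrow> 0 < - a + - b + - c" for a b c :: real by simp
    note \<open>0 < euclidean_weight (M1 t) (M2 t) (M3 t) (q1 t) (q2 t) (q3 t) / M1 t * (x2-x3)^2 + _ + _\<close>
    also have "euclidean_weight (M1 t) (M2 t) (M3 t) (q1 t) (q2 t) (q3 t) / M1 t * (x2-x3)^2
        + euclidean_weight (M2 t) (M1 t) (M3 t) (q2 t) (q1 t) (q3 t) / M2 t * (x1-x3)^2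
     + euclidean_weight (M3 t) (M1 t) (M2 t) (q3 t) (q1 t) (q2 t) / M3 t * (x1-x2)^2
         = - (2 * (x1 * (d1 t - d2 t*((M1 t + M2 t - M3 t)/(2*M2 t)) - d3 t*((M1 t+M3 t-M2 t)/(2*M3 t)))
       + x2*(d2 t - d1 t*((M2 t+M1 t-M3 t)/(2*M1 t)) - d3 t*((M2 t+M3 t-M1 t)/(2*M3 t)))
       + x3*(d3 t - d1 t*((M3 t+M1 t-M2 t)/(2*M1 t)) - d2 t*((M3 t+M2 t-M1 t)/(2*M2 t)))))"
      unfolding d1_def d2_def d3_def euclidean_angle_variation[OF M(1-3)[of t]] by simp
    finally show ?thesis
      unfolding coeff[OF M(2) M(3)] coeff[OF M(1) M(3)] coeff[OF M(1) M(2)] mult_minus_right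
      using halve by blast
  qed
  have *: "x1 * clamped_arccos ((M2 1 + M3 1 - M1 1) / sqrt (4 * M2 1 * M3 1))
    + x2 * clamped_arccos ((M1 1 + M3 1 - M2 1) / sqrt (4 * M1 1 * M3 1))
    + x3 * clamped_arccos ((M1 1 + M2 1 - M3 1) / sqrt (4 * M1 1 * M2 1))
     < x1 * clamped_arccos ((M2 0 + M3 0 - M1 0) / sqrt (4 * M2 0 * M3 0))
    + x2 * clamped_arccos ((M1 0 + M3 0 - M2 0) / sqrt (4 * M1 0 * M3 0))
    + x3 * clamped_arccos ((M1 0 + M2 0 - M3 0) / sqrt (4 * M1 0 * M2 0))"
  proof (rule weighted_angle_sum_decreases[where
        N1' = "\<lambda>t. d2 t + d3 t - d1 t" and N2' = "\<lambda>t. d1 t + d3 t - d2 t" and N3' = "\<lambda>t. d1 t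
            + d2 t - d3 t" and
        s1' = "\<lambda>t. 4 * (d2 t * M3 t + M2 t * d3 t)" and s2' = "\<lambda>t. 4 * (d1 t * M3 t + M1 t * d3 t)" and
        s3' = "\<lambda>t. 4 * (d1 t * M2 t + M1 t * d2 t)" and \<Delta> = "\<lambda>t. heron (M1 t) (M2 t) (M3 t)"])
    show "heron (M1 0) (M2 0) (M3 0) > 0"
      using heron unfolding M1_def M2_def M3_def R0 L1_def L2_def L3_def .
  qed (use M pos in \<open>auto intro!: derivative_eq_intros dM simp: heron_def algebra_simps power2_eq_square\<close>)
  then show ?thesis
    unfolding euclidean_corner_def M1_def M2_def M3_def R0 R1 L1_def L2_def L3_def L1'_def L2'_def L3'_def
    by simp
qed

section \<open>Variation of the angles of a hyperbolic triangle\<close>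

text \<open>The determinant of the matrix \<open>X\<close> with diagonal 1 and off-diagonal entries the hyperbolic
  cosines \<open>c1\<close>, \<open>c2\<close>, \<open>c3\<close> of the side lengths, that is, of the negated Lorentz products of the
  vertices. It is the hyperbolic counterpart of Heron's expression.\<close>

definition gram_det :: "real \<Rightarrow> real \<Rightarrow> real \<Rightarrow> real" where
  "gram_det c1 c2 c3 = 1 + 2*c1*c2*c3 - c1\<^sup>2 - c2\<^sup>2 - c3\<^sup>2"

text \<open>The first entry of \<open>adj X\<close>, with \<open>X\<close> as for \<open>gram_det\<close>, applied to the vector of the \<open>Ci = cosh ri\<close>.
  Since the radical center is the vector whose Lorentz products with the vertices are the \<open>-Ci\<close>, this
  is a positive multiple of its first coordinate in the basis of the vertices if the triangle is nondegenerate.\<close>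

definition hyperbolic_weight :: "real \<Rightarrow> real \<Rightarrow> real \<Rightarrow> real \<Rightarrow> real \<Rightarrow> real \<Rightarrow> real" where
  "hyperbolic_weight c1 c2 c3 C1 C2 C3 = C2*(c1*c2-c3) + C3*(c1*c3-c2) - (c1\<^sup>2-1)*C1"

text \<open>The counterpart of \<open>euclidean_angle_variation\<close> for velocities of \<open>ln (tanh (ri / 2))\<close>: with this
  parameter the derivative of \<open>c3 = C1 * C2 + I3 * S1 * S2\<close> in the direction 1 is \<open>c3 * C1 - C2\<close>, so
  the inversive distances disappear and an identity between the \<open>ci\<close> and the \<open>Ci\<close> remains.\<close>

lemma hyperbolic_angle_variation:
  fixes c1 c2 c3 C1 C2 C3 x1 x2 x3 :: real
  assumes "c1 > 1" "c2 > 1" "c3 > 1"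
  defines "d1 \<equiv> (c1*C2-C3)*x2+(c1*C3-C2)*x3"
    and "d2 \<equiv> (c2*C1-C3)*x1+(c2*C3-C1)*x3"
    and "d3 \<equiv> (c3*C1-C2)*x1+(c3*C2-C1)*x2"
  shows "x1*(d1-d2*((c1*c2-c3)/(c2^2-1))-d3*((c1*c3-c2)/(c3^2-1)))
       + x2*(d2-d1*((c1*c2-c3)/(c1^2-1))-d3*((c2*c3-c1)/(c3^2-1)))
       + x3*(d3-d1*((c1*c3-c2)/(c1^2-1))-d2*((c2*c3-c1)/(c2^2-1)))
    = -(hyperbolic_weight c1 c2 c3 C1 C2 C3/(c1^2-1)*(c1*(x2^2+x3^2)-2*x2*x3)
       +hyperbolic_weight c2 c1 c3 C2 C1 C3/(c2^2-1)*(c2*(x1^2+x3^2)-2*x1*x3)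
       +hyperbolic_weight c3 c1 c2 C3 C1 C2/(c3^2-1)*(c3*(x1^2+x2^2)-2*x1*x2))"
proof -
  define s1 s2 s3 where "s1 = c1^2-1" and "s2 = c2^2-1" and "s3 = c3^2-1"
  have "c1^2 > 1" "c2^2 > 1" "c3^2 > 1" using assms by (simp_all add: one_less_power)
  then have s: "s1 \<noteq> 0" "s2 \<noteq> 0" "s3 \<noteq> 0" unfolding s1_def s2_def s3_def by auto
  define w1 w2 w3 where "w1 = hyperbolic_weight c1 c2 c3 C1 C2 C3" and "w2
      = hyperbolic_weight c2 c1 c3 C2 C1 C3" and "w3 = hyperbolic_weight c3 c1 c2 C3 C1 C2"
  have e1: "d1 * ((c1*c2-c3)*x2 + (c1*c3-c2)*x3) / s1 = w1/s1*(c1*(x2^2+x3^2)-2*x2*x3) + 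
       ((c1*C1-c3*C3)*x2^2 + (c1*C1-c2*C2)*x3^2 + (c2*C3-C1 + c3*C2-C1)*x2*x3)"
  proof -
    have "d1 * ((c1*c2-c3)*x2 + (c1*c3-c2)*x3) = w1*(c1*(x2^2+x3^2)-2*x2*x3) + 
       s1*((c1*C1-c3*C3)*x2^2 + (c1*C1-c2*C2)*x3^2 + (c2*C3-C1 + c3*C2-C1)*x2*x3)"
      unfolding d1_def w1_def hyperbolic_weight_def s1_def by (simp add: algebra_simps power2_eq_square)
    then show ?thesis using s(1) by (simp add: add_divide_distrib)
  qed
  have e2: "d2 * ((c1*c2-c3)*x1 + (c2*c3-c1)*x3) / s2 = w2/s2*(c2*(x1^2+x3^2)-2*x1*x3) + 
       ((c2*C2-c3*C3)*x1^2 + (c2*C2-c1*C1)*x3^2 + (c1*C3-C2 + c3*C1-C2)*x1*x3)"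
  proof -
    have "d2 * ((c1*c2-c3)*x1 + (c2*c3-c1)*x3) = w2*(c2*(x1^2+x3^2)-2*x1*x3) + 
       s2*((c2*C2-c3*C3)*x1^2 + (c2*C2-c1*C1)*x3^2 + (c1*C3-C2 + c3*C1-C2)*x1*x3)"
      unfolding d2_def w2_def hyperbolic_weight_def s2_def by (simp add: algebra_simps power2_eq_square)
    then show ?thesis using s(2) by (simp add: add_divide_distrib)
  qed
  have e3: "d3 * ((c1*c3-c2)*x1 + (c2*c3-c1)*x2) / s3 = w3/s3*(c3*(x1^2+x2^2)-2*x1*x2) + 
       ((c3*C3-c2*C2)*x1^2 + (c3*C3-c1*C1)*x2^2 + (c1*C2-C3 + c2*C1-C3)*x1*x2)"
  proof -
    have "d3 * ((c1*c3-c2)*x1 + (c2*c3-c1)*x2) = w3*(c3*(x1^2+x2^2)-2*x1*x2) + 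
       s3*((c3*C3-c2*C2)*x1^2 + (c3*C3-c1*C1)*x2^2 + (c1*C2-C3 + c2*C1-C3)*x1*x2)"
      unfolding d3_def w3_def hyperbolic_weight_def s3_def by (simp add: algebra_simps power2_eq_square)
    then show ?thesis using s(3) by (simp add: add_divide_distrib)
  qed
  \<comment> \<open>In the sum of the three remainders the squares cancel and the mixed terms add up to
      \<open>x1*d1 + x2*d2 + x3*d3\<close>.\<close>
  have "x1*(d1-d2*((c1*c2-c3)/s2)-d3*((c1*c3-c2)/s3))
       + x2*(d2-d1*((c1*c2-c3)/s1)-d3*((c2*c3-c1)/s3))
       + x3*(d3-d1*((c1*c3-c2)/s1)-d2*((c2*c3-c1)/s2))
     = x1*d1 + x2*d2 + x3*d3 - d1 * ((c1*c2-c3)*x2 + (c1*c3-c2)*x3) / s1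
        - d2 * ((c1*c2-c3)*x1 + (c2*c3-c1)*x3) / s2 - d3 * ((c1*c3-c2)*x1 + (c2*c3-c1)*x2) / s3"
    by (simp add: algebra_simps add_divide_distrib diff_divide_distrib)
  also have "\<dots> = -
      (w1/s1*(c1*(x2^2+x3^2)-2*x2*x3)+w2/s2*(c2*(x1^2+x3^2)-2*x1*x3)+w3/s3*(c3*(x1^2+x2^2)-2*x1*x2))"
    unfolding e1 e2 e3 unfolding d1_def d2_def d3_def by (simp add: algebra_simps power2_eq_square)
  finally show ?thesis unfolding s1_def s2_def s3_def w1_def w2_def w3_def .
qed

lemma det_product_3:
  fixes a b :: "nat \<Rightarrow> nat \<Rightarrow> real"
  defines "d \<equiv> \<lambda>a :: nat \<Rightarrow> nat \<Rightarrow> real. a 1 1 * a 2 2 * a 3 3 + a 1 2 * a 2 3 * a 3 1 + a 1 3 * a 2 1 * a 3 2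
     - a 1 1 * a 2 3 * a 3 2 - a 1 2 * a 2 1 * a 3 3 - a 1 3 * a 2 2 * a 3 1"
  shows "d (\<lambda>i j. a i 1 * b 1 j + a i 2 * b 2 j + a i 3 * b 3 j) = d a * d b"
  unfolding d_def by (simp add: algebra_simps)

text \<open>The matrix of the form is the product of the adjugate of the matrix of hyperbolic cosines, whose
  determinant is the square of \<open>gram_det\<close>, a positive diagonal matrix, and the matrix of the
  derivatives of the \<open>ci\<close>. The last one has zero diagonal, so its determinant is the sum of the two
  cyclic products.\<close>

lemma hyperbolic_form_determinant:
  fixes c1 c2 c3 C1 C2 C3 :: real
  assumes "c1 > 1" "c2 > 1" "c3 > 1"
  defines "W1 \<equiv> hyperbolic_weight c1 c2 c3 C1 C2 C3 / (c1^2-1)" and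
      "W2 \<equiv> hyperbolic_weight c2 c1 c3 C2 C1 C3 / (c2^2-1)" and
      "W3 \<equiv> hyperbolic_weight c3 c1 c2 C3 C1 C2 / (c3^2-1)"
  defines "a \<equiv> c2*W2+c3*W3" and "b \<equiv> c1*W1+c3*W3" and "c \<equiv> c1*W1+c2*W2"
  shows "(a*b*c - 2*W1*W2*W3 - a*W1^2 - b*W2^2 - c*W3^2) * ((c1^2-1)*(c2^2-1)*(c3^2-1)) =
     (gram_det c1 c2 c3)^2 * ((c3*C1-C2)*(c1*C2-C3)*(c2*C3-C1)+(c3*C2-C1)*(c1*C3-C2)*(c2*C1-C3))"
proof -
  define s1 s2 s3 where "s1 = c1^2-1" and "s2 = c2^2-1" and "s3 = c3^2-1"
  have "c1^2 > 1" "c2^2 > 1" "c3^2 > 1" using assms by (simp_all add: one_less_power)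
  then have s: "s1 \<noteq> 0" "s2 \<noteq> 0" "s3 \<noteq> 0" unfolding s1_def s2_def s3_def by auto
  define x12 x13 x23 where "x12 = c1*c2-c3" and "x13 = c1*c3-c2" and "x23 = c2*c3-c1"
  define p12 p13 p21 p23 p31 p32 where "p12 = c1*C2-C3" and "p13 = c1*C3-C2" and "p21 = c2*C1-C3"
    and "p23 = c2*C3-C1" and "p31 = c3*C1-C2" and "p32 = c3*C2-C1"
  note xp_defs = x12_def x13_def x23_def p12_def p13_def p21_def p23_def p31_def p32_def
  \<comment> \<open>\<open>X\<close> is the adjugate of the matrix of hyperbolic cosines, and \<open>P\<close> is the matrix of the partial
      derivatives of the \<open>ci\<close>, with row \<open>i\<close> divided by \<open>si\<close>. The matrix of the form is \<open>Q = X P\<close>.\<close>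
  define X where "X = (\<lambda>(i::nat) (j::nat). if i = 1 then (if j = 1 then - s1 else if j = 2 then x12 else x13)
     else if i = 2 then (if j = 1 then x12 else if j = 2 then - s2 else x23)
     else (if j = 1 then x13 else if j = 2 then x23 else - s3))"
  define P where "P = (\<lambda>(i::nat) (j::nat). if i = 1 then (if j = 1 then 0 else if j
      = 2 then p12/s1 else p13/s1)
     else if i = 2 then (if j = 1 then p21/s2 else if j = 2 then 0 else p23/s2)
     else (if j = 1 then p31/s3 else if j = 2 then p32/s3 else 0))"
  define Q where "Q = (\<lambda>i j. X i 1 * P 1 j + X i 2 * P 2 j + X i 3 * P 3 j)"
  define d where "d = (\<lambda>a :: nat \<Rightarrow> nat \<Rightarrow> real. a 1 1 * a 2 2 * a 3 3 + a 1 2 * a 2 3 * a 3 1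
      + a 1 3 * a 2 1 * a 3 2
     - a 1 1 * a 2 3 * a 3 2 - a 1 2 * a 2 1 * a 3 3 - a 1 3 * a 2 2 * a 3 1)"
  define w1 w2 w3 where "w1 = hyperbolic_weight c1 c2 c3 C1 C2 C3" and "w2
      = hyperbolic_weight c2 c1 c3 C2 C1 C3" and "w3 = hyperbolic_weight c3 c1 c2 C3 C1 C2"
  have W: "W1 = w1/s1" "W2 = w2/s2" "W3 = w3/s3"
    unfolding W1_def W2_def W3_def w1_def w2_def w3_def s1_def s2_def s3_def by auto
  have offdiag: "Q 1 2 = - W3" "Q 1 3 = - W2" "Q 2 1 = - W3" "Q 2 3 = - W1" "Q 3 1 = - W2" "Q 3 2 = - W1"
  proof -
    have "x13*p32 = s3 * p12 - w3" "x12*p23 = s2 * p13 - w2" "x23*p31 = s3 * p21 - w3"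
      "x12*p13 = s1 * p23 - w1" "x23*p21 = s2 * p31 - w2" "x13*p12 = s1 * p32 - w1"
      unfolding w1_def w2_def w3_def hyperbolic_weight_def s1_def s2_def s3_def xp_defs
          by (simp_all add: algebra_simps power2_eq_square)
    then show "Q 1 2 = - W3" "Q 1 3 = - W2" "Q 2 1 = - W3" "Q 2 3 = - W1" "Q 3 1 = - W2" "Q 3 2 = - W1"
      unfolding Q_def X_def P_def W using s by (simp_all add: diff_divide_distrib)
  qed
  have diag: "Q 1 1 = a" "Q 2 2 = b" "Q 3 3 = c"
  proof -
    have "x12*p21 = c2*w2 + s2*(c2*C2-c3*C3)" "x13*p31 = c3*w3 + s3*(c3*C3-c2*C2)"
      "x12*p12 = c1*w1 + s1*(c1*C1-c3*C3)" "x23*p32 = c3*w3 + s3*(c3*C3-c1*C1)"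
      "x13*p13 = c1*w1 + s1*(c1*C1-c2*C2)" "x23*p23 = c2*w2 + s2*(c2*C2-c1*C1)"
      unfolding w1_def w2_def w3_def hyperbolic_weight_def s1_def s2_def s3_def xp_defs
          by (simp_all add: algebra_simps power2_eq_square)
    then show "Q 1 1 = a" "Q 2 2 = b" "Q 3 3 = c"
      unfolding Q_def X_def P_def W a_def b_def c_def using s by (simp_all add: add_divide_distrib)
  qed
  have "a*b*c - 2*W1*W2*W3 - a*W1^2 - b*W2^2 - c*W3^2 = d Q"
    unfolding d_def offdiag diag by (simp add: algebra_simps power2_eq_square)
  also have "\<dots> = d X * d P" unfolding Q_def d_def using det_product_3 .
  also have "d X = (gram_det c1 c2 c3)^2"
    unfolding d_def X_def gram_det_def s1_def s2_def s3_def xp_defs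
        by (simp add: algebra_simps power2_eq_square)
  also have "d P = (p31*p12*p23 + p32*p13*p21) / (s1 * s2 * s3)"
    unfolding d_def P_def using s by (simp add: field_simps)
  finally show ?thesis using s unfolding xp_defs s1_def s2_def s3_def by simp
qed

text \<open>A binary form with positive determinant is definite, and one positive value decides its sign.\<close>

lemma binary_form_pos:
  fixes p q e :: real
  assumes "p * q - e\<^sup>2 > 0" and v: "p * v1\<^sup>2 + 2 * e * v1 * v2 + q * v2\<^sup>2 > 0" and y: "\<not> (y1 = 0 \<and> y2 = 0)"
  shows "p * y1\<^sup>2 + 2 * e * y1 * y2 + q * y2\<^sup>2 > 0"
proof -
  have eq: "p * (p * z1\<^sup>2 + 2 * e * z1 * z2 + q * z2\<^sup>2) = (p * z1 + e * z2)\<^sup>2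
      + (p * q - e\<^sup>2) * z2\<^sup>2" for z1 z2
    by (simp add: algebra_simps power2_eq_square)
  have "p \<noteq> 0" using assms(1) by auto
  have "p * (p * v1\<^sup>2 + 2 * e * v1 * v2 + q * v2\<^sup>2) \<ge> 0" unfolding eq using assms(1) by simp
  then have "p > 0" using v \<open>p \<noteq> 0\<close> by (simp add: zero_le_mult_iff)
  have "p * (p * y1\<^sup>2 + 2 * e * y1 * y2 + q * y2\<^sup>2) > 0"
    unfolding eq using assms(1) y \<open>p > 0\<close> by (cases "y2 = 0") (auto intro: add_nonneg_pos)
  then show ?thesis using \<open>p > 0\<close> by (simp add: zero_less_mult_iff)
qed

text \<open>The form is positive on the first basis vector and on a vector \<open>m\<close> orthogonal to it, hence positive
  definite on a plane. A positive determinant leaves no room for a single negative direction.\<close>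

lemma ternary_form_pos:
  fixes a b c f g h :: real
  assumes a: "a > 0" and det: "a*b*c + 2*f*g*h - a*f^2 - b*g^2 - c*h^2 > 0"
    and v: "a * m1^2 + b * m2^2 + c * m3^2 + 2*f*m2*m3 + 2*g*m1*m3 + 2*h*m1*m2 > 0"
    and orth: "a * m1 + h * m2 + g * m3 = 0"
    and x: "\<not> (x1 = 0 \<and> x2 = 0 \<and> x3 = 0)"
  shows "a * x1^2 + b * x2^2 + c * x3^2 + 2*f*x2*x3 + 2*g*x1*x3 + 2*h*x1*x2 > 0"
proof -
  \<comment> \<open>\<open>N\<close> is \<open>a\<close> times the form induced on the orthogonal complement of the first basis vector. Its
      determinant is \<open>a\<close> times that of the whole form.\<close>
  define N where "N = (\<lambda>y2 y3. (a*b - h^2) * y2^2 + 2 * (a*f - g*h) * y2 * y3 + (a*c - g^2) * y3^2)"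
  have eq: "a * (a * z1^2 + b * z2^2 + c * z3^2 + 2*f*z2*z3 + 2*g*z1*z3 + 2*h*z1*z2)
     = (a * z1 + h * z2 + g * z3)^2 + N z2 z3" for z1 z2 z3
    unfolding N_def by (simp add: algebra_simps power2_eq_square)
  have "N m2 m3 > 0" using eq[of m1 m2 m3] orth v a by (metis add_0 mult_pos_pos zero_power2)
  have "(a*b - h^2) * (a*c - g^2) - (a*f - g*h)^2 = a * (a*b*c + 2*f*g*h - a*f^2 - b*g^2 - c*h^2)"
    by (simp add: algebra_simps power2_eq_square)
  then have "(a*b - h^2) * (a*c - g^2) - (a*f - g*h)^2 > 0" using a det by simp
  then have N: "N x2 x3 > 0" if "\<not> (x2 = 0 \<and> x3 = 0)"
    using binary_form_pos[OF _ _ that] \<open>N m2 m3 > 0\<close> unfolding N_def by blast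
  have "(a * x1 + h * x2 + g * x3)^2 + N x2 x3 > 0"
  proof (cases "x2 = 0 \<and> x3 = 0")
    case True
    then show ?thesis using x a unfolding N_def by simp
  next
    case False
    then show ?thesis using N by (intro add_nonneg_pos) auto
  qed
  then show ?thesis unfolding eq[symmetric] using a by (simp add: zero_less_mult_iff)
qed

text \<open>Only the first weight may be negative. If it is not, every summand is nonnegative because \<open>ci > 1\<close>,
  and the two positive weights involve all three variables. If it is negative, the vector
  \<open>(1, c3, c2)\<close> satisfies the assumptions of \<open>ternary_form_pos\<close>: it is
  orthogonal to the first basis vector, and the form takes the value
  \<open>gram_det c1 c2 c3 / (c1\<^sup>2 - 1) * ((c1*C2-C3)*c3 + (c1*C3-C2)*c2)\<close> on it.\<close>

lemma hyperbolic_weighted_form_pos: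
  fixes c1 c2 c3 C1 C2 C3 x1 x2 x3 :: real
  assumes c: "c1 > 1" "c2 > 1" "c3 > 1" and A: "gram_det c1 c2 c3 > 0"
    and w: "hyperbolic_weight c2 c1 c3 C2 C1 C3 > 0" "hyperbolic_weight c3 c1 c2 C3 C1 C2 > 0"
    and w1: "hyperbolic_weight c1 c2 c3 C1 C2 C3 < 0 \<Longrightarrow> c1*C2-C3 > 0 \<and> c1*C3-C2 > 0"
    and P: "(c3*C1-C2)*(c1*C2-C3)*(c2*C3-C1)+(c3*C2-C1)*(c1*C3-C2)*(c2*C1-C3) > 0"
    and x: "\<not> (x1 = 0 \<and> x2 = 0 \<and> x3 = 0)"
  shows "hyperbolic_weight c1 c2 c3 C1 C2 C3/(c1^2-1)*(c1*(x2^2+x3^2)-2*x2*x3)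
       +hyperbolic_weight c2 c1 c3 C2 C1 C3/(c2^2-1)*(c2*(x1^2+x3^2)-2*x1*x3)
       +hyperbolic_weight c3 c1 c2 C3 C1 C2/(c3^2-1)*(c3*(x1^2+x2^2)-2*x1*x2) > 0"
proof -
  define s1 s2 s3 where "s1 = c1^2-1" and "s2 = c2^2-1" and "s3 = c3^2-1"
  have "c1^2 > 1" "c2^2 > 1" "c3^2 > 1" using c by (simp_all add: one_less_power)
  then have s: "s1 > 0" "s2 > 0" "s3 > 0" unfolding s1_def s2_def s3_def by auto
  define W1 W2 W3 where "W1 = hyperbolic_weight c1 c2 c3 C1 C2 C3/s1" and "W2
      = hyperbolic_weight c2 c1 c3 C2 C1 C3/s2" and "W3 = hyperbolic_weight c3 c1 c2 C3 C1 C2/s3"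
  have W: "W2 > 0" "W3 > 0" unfolding W2_def W3_def using w s by auto
  have "W1*(c1*(x2^2+x3^2)-2*x2*x3) + W2*(c2*(x1^2+x3^2)-2*x1*x3) + W3*(c3*(x1^2+x2^2)-2*x1*x2) > 0"
  proof (cases "hyperbolic_weight c1 c2 c3 C1 C2 C3 < 0")
    case False
    have nonneg: "k * (y^2 + z^2) - 2*y*z \<ge> 0" if "k > 1" for k y z :: real
    proof -
      have "k * (y^2 + z^2) - 2*y*z = (k-1)*(y^2+z^2) + (y-z)^2" by (simp add: algebra_simps power2_eq_square)
      also have "\<dots> \<ge> 0" using that by simp
      finally show ?thesis .
    qed
    have pos: "k * (y^2 + z^2) - 2*y*z > 0" if "k > 1" "\<not> (y = 0 \<and> z = 0)" for k y z :: real
    proof -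
      have "k * (y^2 + z^2) - 2*y*z = (k-1)*(y^2+z^2) + (y-z)^2" by (simp add: algebra_simps power2_eq_square)
      moreover have "(k-1)*(y^2+z^2) > 0" using that by (simp add: sum_power2_gt_zero_iff)
      ultimately show ?thesis by (simp add: add_pos_nonneg)
    qed
    have "W1 \<ge> 0" unfolding W1_def using False s by simp
    then have 1: "W1*(c1*(x2^2+x3^2)-2*x2*x3) \<ge> 0" using nonneg[OF c(1)] by simp
    have 2: "W2*(c2*(x1^2+x3^2)-2*x1*x3) \<ge> 0" "W3*(c3*(x1^2+x2^2)-2*x1*x2) \<ge> 0"
      using nonneg c W by simp_all
    have "W2*(c2*(x1^2+x3^2)-2*x1*x3) > 0 \<or> W3*(c3*(x1^2+x2^2)-2*x1*x2) > 0"
      using pos[OF c(2), of x1 x3] pos[OF c(3), of x1 x2] W x by auto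
    with 1 2 show ?thesis by linarith
  next
    case True
    define a b c where "a = c2*W2+c3*W3" and "b = c1*W1+c3*W3" and "c = c1*W1+c2*W2"
    have p: "c1*C2-C3 > 0" "c1*C3-C2 > 0" using w1[OF True] by auto
    have "(a*b*c - 2*W1*W2*W3 - a*W1^2 - b*W2^2 - c*W3^2) * (s1 * s2 * s3) > 0"
      unfolding a_def b_def c_def W1_def W2_def W3_def s1_def s2_def s3_def
      unfolding hyperbolic_form_determinant[OF assms(1-3)] using A P by simp
    then have det: "a*b*c - 2*W1*W2*W3 - a*W1^2 - b*W2^2 - c*W3^2 > 0"
      by (rule zero_less_mult_pos2) (use s in simp)
    \<comment> \<open>The vector \<open>(1, c3, c2)\<close>, the first column of the matrix of hyperbolic cosines, is orthogonal to
        the first basis vector, and the form is positive on it.\<close>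
    have "a * 1^2 + b * c3^2 + c * c2^2 + 2*(-W1)*c3*c2 + 2*(-W2)*1*c2 + 2*(-W3)*1*c3
        = c3*(s3*W3) + c2*(s2*W2) + W1*(c1*c3^2+c1*c2^2-2*c2*c3)"
      unfolding a_def b_def c_def s2_def s3_def by (simp add: algebra_simps power2_eq_square)
    also have "\<dots> = gram_det c1 c2 c3 / s1 * ((c1*C2-C3)*c3+(c1*C3-C2)*c2)"
    proof -
      have "s1 * (c3 * hyperbolic_weight c3 c1 c2 C3 C1 C2 + c2 * hyperbolic_weight c2 c1 c3 C2 C1 C3)
          + hyperbolic_weight c1 c2 c3 C1 C2 C3 * (c1*c3^2+c1*c2^2-2*c2*c3)
         = gram_det c1 c2 c3 * ((c1*C2-C3)*c3+(c1*C3-C2)*c2)"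
        unfolding s1_def hyperbolic_weight_def gram_det_def by (simp add: algebra_simps power2_eq_square)
      moreover have "c3*(s3*W3) + c2*(s2*W2) + W1*(c1*c3^2+c1*c2^2-2*c2*c3)
         = (s1 * (c3 * hyperbolic_weight c3 c1 c2 C3 C1 C2 + c2 * hyperbolic_weight c2 c1 c3 C2 C1 C3)
             + hyperbolic_weight c1 c2 c3 C1 C2 C3 * (c1*c3^2+c1*c2^2-2*c2*c3)) / s1"
        unfolding W1_def W2_def W3_def using s by (simp add: add_divide_distrib)
      ultimately show ?thesis by simp
    qed
    also have "\<dots> > 0" using A s p assms(1-3) by (intro mult_pos_pos divide_pos_pos add_pos_pos) auto
    finally have v: "a * 1^2 + b * c3^2 + c * c2^2 + 2*(-W1)*c3*c2 + 2*(-W2)*1*c2 + 2*(-W3)*1*c3 > 0" .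
    have "a * x1^2 + b * x2^2 + c * x3^2 + 2*(-W1)*x2*x3 + 2*(-W2)*x1*x3 + 2*(-W3)*x1*x2 > 0"
    proof (rule ternary_form_pos[OF _ _ v])
      show "a > 0" unfolding a_def using W assms(1-3) by (intro add_pos_pos mult_pos_pos) auto
      show "0 < a * b * c + 2 * - W1 * - W2 * - W3 - a * (- W1)\<^sup>2 - b * (- W2)\<^sup>2 - c * (- W3)\<^sup>2"
        using det by simp
      show "a * 1 + - W3 * c3 + - W2 * c2 = 0" unfolding a_def by simp
    qed (fact x)
    then show ?thesis unfolding a_def b_def c_def by (simp add: algebra_simps)
  qed
  then show ?thesis unfolding W1_def W2_def W3_def s1_def s2_def s3_def .
qed

text \<open>The angle opposite the side of length \<open>arcosh c1\<close>, extended to degenerate lengths.\<close>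

definition hyperbolic_corner :: "real \<Rightarrow> real \<Rightarrow> real \<Rightarrow> real" where
  "hyperbolic_corner c1 c2 c3 = clamped_arccos ((c2 * c3 - c1) / sqrt ((c2\<^sup>2 - 1) * (c3\<^sup>2 - 1)))"

lemma cosh_sinh_combination_gt_1:
  fixes C2 C3 S2 S3 I :: real
  assumes C: "C2\<^sup>2 = S2\<^sup>2 + 1" "C3\<^sup>2 = S3\<^sup>2 + 1" "C2 > 0" "C3 > 0" and S: "S2 > 0" "S3 > 0" and I: "-1 < I"
  shows "C2 * C3 + I * S2 * S3 > 1"
proof -
  have "(C2 * C3)\<^sup>2 = (1 + S2 * S3)\<^sup>2 + (S2 - S3)\<^sup>2"
    unfolding power_mult_distrib C by (simp add: algebra_simps power2_eq_square)
  then have "(1 + S2 * S3)\<^sup>2 \<le> (C2 * C3)\<^sup>2" by simp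
  then have "1 + S2 * S3 \<le> C2 * C3" by (rule power2_le_imp_le) (use C in simp)
  moreover have "0 < (1 + I) * (S2 * S3)" using I S by simp
  ultimately show ?thesis by (simp add: algebra_simps)
qed

text \<open>The matrix of hyperbolic cosines is \<open>C C\<^sup>T - S G S\<close>, where \<open>C\<close> is the column of the \<open>Ci\<close>, \<open>S\<close> is the
  diagonal matrix of the \<open>Si\<close>, and \<open>G\<close> has diagonal 1 and off-diagonal entries \<open>- Ii\<close>. The rank
  one term \<open>C C\<^sup>T\<close> does not change the product of the adjugate with \<open>C\<close>, so the weights are those of \<open>S G S\<close>.\<close>

lemma hyperbolic_weight_eq_radical_coordinate:
  fixes C1 C2 C3 S1 S2 S3 I1 I2 I3 :: real
  assumes C: "C1\<^sup>2 = S1\<^sup>2 + 1" "C2\<^sup>2 = S2\<^sup>2 + 1" "C3\<^sup>2 = S3\<^sup>2 + 1" and S: "S1 > 0" "S2 > 0" "S3 > 0"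
  defines "c1 \<equiv> C2 * C3 + I1 * S2 * S3" and "c2 \<equiv> C1 * C3 + I2 * S1 * S3" and "c3 \<equiv> C1 * C2 + I3 * S1 * S2"
  shows "hyperbolic_weight c1 c2 c3 C1 C2 C3 = S1 * S2\<^sup>2 * S3\<^sup>2 * radical_coordinate I1 I2 I3 (C1 / S1)
      (C2 / S2) (C3 / S3)"
proof -
  \<comment> \<open>Replacing the diagonal entries 1 of the matrix of hyperbolic cosines by \<open>Ci\<^sup>2 - Si\<^sup>2\<close> turns the
      claim into a polynomial identity.\<close>
  have one: "1 = C2\<^sup>2 - S2\<^sup>2" "1 = C3\<^sup>2 - S3\<^sup>2" using C by auto
  have "hyperbolic_weight c1 c2 c3 C1 C2 C3 = C2 * (c1 * c2 - c3 * 1)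
      + C3 * (c1 * c3 - c2 * 1) - (c1\<^sup>2 - 1 * 1) * C1"
    unfolding hyperbolic_weight_def by simp
  also have "\<dots> = C2 * (c1 * c2 - c3 * (C3\<^sup>2 - S3\<^sup>2)) + C3 * (c1 * c3 - c2 * (C2\<^sup>2 - S2\<^sup>2))
      - (c1\<^sup>2 - (C2\<^sup>2 - S2\<^sup>2) * (C3\<^sup>2 - S3\<^sup>2)) * C1"
    using one by simp
  also have "\<dots> = S2\<^sup>2 * S3\<^sup>2 * C1 * (1 - I1\<^sup>2) + S1 * S2 * S3\<^sup>2 * C2 * (I3 + I1 * I2)
      + S1 * S2\<^sup>2 * S3 * C3 * (I2 + I1 * I3)"
    unfolding c1_def c2_def c3_def by (simp add: algebra_simps power2_eq_square)
  also have "\<dots> = S1 * S2\<^sup>2 * S3\<^sup>2 * radical_coordinate I1 I2 I3 (C1 / S1) (C2 / S2) (C3 / S3)"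
    unfolding radical_coordinate_def using S by (simp add: field_simps power2_eq_square)
  finally show ?thesis .
qed

lemma gram_det_commute:
  "gram_det c2 c1 c3 = gram_det c1 c2 c3" "gram_det c1 c3 c2 = gram_det c1 c2 c3"
  unfolding gram_det_def by (simp_all add: algebra_simps)

lemma hyperbolic_weight_swap: "hyperbolic_weight c1 c3 c2 C1 C3 C2 = hyperbolic_weight c1 c2 c3 C1 C2 C3"
  unfolding hyperbolic_weight_def by (simp add: algebra_simps)

text \<open>A negative radical coordinate forces the opposite inversive distance to exceed 1, and then the
  derivatives \<open>c1*C2-C3 = S2\<^sup>2 * S3 * (k3 + I1 * k2)\<close> and \<open>c1*C3-C2\<close> are positive, as
  \<open>hyperbolic_weighted_form_pos\<close> demands. The three cases below differ only by the vertex at which the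
  coordinate may be negative.\<close>

lemma hyperbolic_form_pos:
  fixes C1 C2 C3 S1 S2 S3 I1 I2 I3 :: real
  assumes adm: "compatible_weights I1 I2 I3"
    and C: "C1\<^sup>2 = S1\<^sup>2 + 1" "C2\<^sup>2 = S2\<^sup>2 + 1" "C3\<^sup>2 = S3\<^sup>2 + 1" and C0: "C1 > 0" "C2 > 0" "C3 > 0"
    and S: "S1 > 0" "S2 > 0" "S3 > 0"
  defines "c1 \<equiv> C2 * C3 + I1 * S2 * S3" and "c2 \<equiv> C1 * C3 + I2 * S1 * S3" and "c3 \<equiv> C1 * C2 + I3 * S1 * S2"
  assumes A: "gram_det c1 c2 c3 > 0" and x: "\<not> (x1 = 0 \<and> x2 = 0 \<and> x3 = 0)"
  shows "hyperbolic_weight c1 c2 c3 C1 C2 C3/(c1^2-1)*(c1*(x2^2+x3^2)-2*x2*x3)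
       +hyperbolic_weight c2 c1 c3 C2 C1 C3/(c2^2-1)*(c2*(x1^2+x3^2)-2*x1*x3)
       +hyperbolic_weight c3 c1 c2 C3 C1 C2/(c3^2-1)*(c3*(x1^2+x2^2)-2*x1*x2) > 0"
proof -
  have I: "-1 < I1" "-1 < I2" "-1 < I3" using adm unfolding compatible_weights_def by auto
  have c: "c1 > 1" "c2 > 1" "c3 > 1"
    unfolding c1_def c2_def c3_def using cosh_sinh_combination_gt_1 C C0 S I by auto
  define k1 k2 k3 where "k1 = C1 / S1" and "k2 = C2 / S2" and "k3 = C3 / S3"
  have k: "k1 > 0" "k2 > 0" "k3 > 0" unfolding k1_def k2_def k3_def using C0 S by auto
  define h1 h2 h3 where "h1 = radical_coordinate I1 I2 I3 k1 k2 k3" and "h2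
      = radical_coordinate I2 I1 I3 k2 k1 k3"
    and "h3 = radical_coordinate I3 I1 I2 k3 k1 k2"
  have comm: "C3 * C1 = C1 * C3" "C2 * C1 = C1 * C2" "C3 * C2 = C2 * C3"
     "I3 * S2 * S1 = I3 * S1 * S2" "I2 * S3 * S1 = I2 * S1 * S3" "I1 * S3 * S2 = I1 * S2 * S3" by simp_all
  have w: "hyperbolic_weight c1 c2 c3 C1 C2 C3 = S1 * S2\<^sup>2 * S3\<^sup>2 * h1"
      "hyperbolic_weight c2 c1 c3 C2 C1 C3 = S2 * S1\<^sup>2 * S3\<^sup>2 * h2"
    "hyperbolic_weight c3 c1 c2 C3 C1 C2 = S3 * S1\<^sup>2 * S2\<^sup>2 * h3"
    unfolding c1_def c2_def c3_def h1_def h2_def h3_def k1_def k2_def k3_def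
    using hyperbolic_weight_eq_radical_coordinate[OF C S, of I1 I2 I3]
        hyperbolic_weight_eq_radical_coordinate[OF C(2) C(1) C(3) S(2) S(1) S(3), of I2 I1 I3]
      hyperbolic_weight_eq_radical_coordinate[OF C(3) C(1) C(2) S(3) S(1) S(2), of I3 I1 I2]
          unfolding comm by simp_all
  have p: "c3*C1-C2 = S1^2*S2*(k2+I3*k1)" "c3*C2-C1 = S2^2*S1*(k1+I3*k2)"
     "c2*C1-C3 = S1^2*S3*(k3+I2*k1)" "c2*C3-C1 = S3^2*S1*(k1+I2*k3)"
     "c1*C2-C3 = S2^2*S3*(k3+I1*k2)" "c1*C3-C2 = S3^2*S2*(k2+I1*k3)"
  proof -
    have *: "(C * D + I * S * T) * C - D = S^2*T*(D/T + I*(C/S))" if "C^2 = S^2 + 1" "S > 0"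
        "T > 0" for C D S T I :: real
    proof -
      have "(C * D + I * S * T) * C - D = C^2 * D - D + I * S * T * C"
          by (simp add: algebra_simps power2_eq_square)
      also have "\<dots> = S^2*T*(D/T + I*(C/S))" unfolding that(1) using that(2,3)
          by (simp add: field_simps power2_eq_square)
      finally show ?thesis .
    qed
    show "c3*C1-C2 = S1^2*S2*(k2+I3*k1)" "c2*C1-C3 = S1^2*S3*(k3+I2*k1)" "c1*C2-C3 = S2^2*S3*(k3+I1*k2)"
      unfolding c1_def c2_def c3_def k1_def k2_def k3_def by (intro * C S)+
    show "c3*C2-C1 = S2^2*S1*(k1+I3*k2)" "c2*C3-C1 = S3^2*S1*(k1+I2*k3)" "c1*C3-C2 = S3^2*S2*(k2+I1*k3)"
      using *[OF C(2) S(2) S(1), of C1 I3] *[OF C(3) S(3) S(1), of C1 I2] *[OF C(3) S(3) S(2), of C2 I1]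
      unfolding c1_def c2_def c3_def k1_def k2_def k3_def comm by simp_all
  qed
  define P where "P = (c3*C1-C2)*(c1*C2-C3)*(c2*C3-C1)+(c3*C2-C1)*(c1*C3-C2)*(c2*C1-C3)"
  have "P = (S1 * S2 * S3)^3 * ((k2 + I3 * k1) * (k3 + I1 * k2) * (k1 + I2 * k3)
           + (k1 + I3 * k2) * (k2 + I1 * k3) * (k3 + I2 * k1))"
  proof -
    have "P = (S1 * S2 * S3)^3 * ((k2 + I3 * k1) * (k3 + I1 * k2) * (k1 + I2 * k3))
           + (S1 * S2 * S3)^3 * ((k1 + I3 * k2) * (k2 + I1 * k3) * (k3 + I2 * k1))"
      unfolding P_def p by (simp only: power2_eq_square power3_eq_cube mult_ac)
    then show ?thesis by (simp only: distrib_left)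
  qed
  then have P: "P > 0" using cyclic_products_pos[OF adm k] S by simp
  have obt: "h1 < 0 \<Longrightarrow> I1 > 1" "h2 < 0 \<Longrightarrow> I2 > 1" "h3 < 0 \<Longrightarrow> I3 > 1"
  proof -
    have adm2: "compatible_weights I2 I1 I3" "compatible_weights I3 I1 I2"
        using adm compatible_weights_swap by blast+
    show "h1 < 0 \<Longrightarrow> I1 > 1" "h2 < 0 \<Longrightarrow> I2 > 1" "h3 < 0 \<Longrightarrow> I3 > 1"
      unfolding h1_def h2_def h3_def
      using weight_gt_1_if_radical_coordinate_neg[OF adm k] weight_gt_1_if_radical_coordinate_neg[OF
          adm2(1) k(2,1,3)] weight_gt_1_if_radical_coordinate_neg[OF adm2(2) k(3,1,2)] by auto
  qed
  have hw: "hyperbolic_weight c1 c2 c3 C1 C2 C3 > 0 \<longleftrightarrow> h1 > 0"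
      "hyperbolic_weight c2 c1 c3 C2 C1 C3 > 0 \<longleftrightarrow> h2 > 0" "hyperbolic_weight c3 c1 c2 C3 C1 C2 > 0 \<longleftrightarrow> h3 > 0"
    "hyperbolic_weight c1 c2 c3 C1 C2 C3 < 0 \<longleftrightarrow> h1 < 0" "hyperbolic_weight c2 c1 c3 C2 C1 C3 < 0 \<longleftrightarrow> h2
        < 0" "hyperbolic_weight c3 c1 c2 C3 C1 C2 < 0 \<longleftrightarrow> h3 < 0"
    unfolding w using S by (simp_all add: zero_less_mult_iff mult_less_0_iff)
  have pp: "I1 > 1 \<Longrightarrow> c1*C2-C3 > 0 \<and> c1*C3-C2 > 0" "I2 > 1 \<Longrightarrow> c2*C1-C3 > 0 \<and> c2*C3-C1 > 0"
      "I3 > 1 \<Longrightarrow> c3*C1-C2 > 0 \<and> c3*C2-C1 > 0"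
    unfolding p using k S by (simp_all add: add_pos_pos)
  have "(h2 > 0 \<and> h3 > 0) \<or> (h1 > 0 \<and> h3 > 0) \<or> (h1 > 0 \<and> h2 > 0)"
    unfolding h1_def h2_def h3_def by (intro two_radical_coordinates_pos adm k)
  then show ?thesis
  proof (elim disjE conjE)
    assume "h2 > 0" "h3 > 0"
    then show ?thesis
      using hyperbolic_weighted_form_pos[OF c A _ _ _ P[unfolded P_def] x] hw obt pp by blast
  next
    assume "h1 > 0" "h3 > 0"
    have P': "0 < (c3*C2-C1)*(c2*C1-C3)*(c1*C3-C2)+(c3*C1-C2)*(c2*C3-C1)*(c1*C2-C3)"
      using P unfolding P_def by (simp add: mult_ac add.commute)
    have "hyperbolic_weight c2 c1 c3 C2 C1 C3/(c2^2-1)*(c2*(x1^2+x3^2)-2*x1*x3)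
       +hyperbolic_weight c1 c2 c3 C1 C2 C3/(c1^2-1)*(c1*(x2^2+x3^2)-2*x2*x3)
       +hyperbolic_weight c3 c2 c1 C3 C2 C1/(c3^2-1)*(c3*(x2^2+x1^2)-2*x2*x1) > 0"
      using \<open>h1 > 0\<close> \<open>h3 > 0\<close> hw obt pp A x
      by (intro hyperbolic_weighted_form_pos[OF c(2,1,3) _ _ _ _ P']) (auto simp: gram_det_commute
          hyperbolic_weight_swap[of c3 c2 c1])
    then show ?thesis by (simp add: hyperbolic_weight_swap[of c3 c2 c1] mult_ac add_ac)
  next
    assume "h1 > 0" "h2 > 0"
    have P': "0 < (c2*C3-C1)*(c3*C1-C2)*(c1*C2-C3)+(c2*C1-C3)*(c3*C2-C1)*(c1*C3-C2)"
      using P unfolding P_def by (simp add: mult_ac add.commute)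
    have "hyperbolic_weight c3 c1 c2 C3 C1 C2/(c3^2-1)*(c3*(x1^2+x2^2)-2*x1*x2)
       +hyperbolic_weight c1 c3 c2 C1 C3 C2/(c1^2-1)*(c1*(x3^2+x2^2)-2*x3*x2)
       +hyperbolic_weight c2 c3 c1 C2 C3 C1/(c2^2-1)*(c2*(x3^2+x1^2)-2*x3*x1) > 0"
      using \<open>h1 > 0\<close> \<open>h2 > 0\<close> hw obt pp A x
      by (intro hyperbolic_weighted_form_pos[OF c(3,1,2) _ _ _ _ P']) (auto simp: gram_det_commute
          hyperbolic_weight_swap[of c1 c3 c2] hyperbolic_weight_swap[of c2 c3 c1])
    then show ?thesis by (simp add: hyperbolic_weight_swap[of c1 c3 c2] hyperbolic_weight_swap[of c2 c3
        c1] mult_ac add_ac)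
  qed
qed

definition cosh_length :: "real \<Rightarrow> real \<Rightarrow> real \<Rightarrow> real" where
  "cosh_length I a b = cosh a * cosh b + I * sinh a * sinh b"

text \<open>In the coordinate \<open>s = tanh (r / 2)\<close> the segment between two logarithms of \<open>s\<close> can be followed
  with rational functions.\<close>

lemma cosh_sinh_half_tanh:
  fixes r :: real
  defines "s \<equiv> tanh (r / 2)"
  shows "(1 + s\<^sup>2) / (1 - s\<^sup>2) = cosh r" and "2 * s / (1 - s\<^sup>2) = sinh r"
proof -
  define a b where "a = cosh (r / 2)" and "b = sinh (r / 2)"
  have a: "a > 0" and ab: "a\<^sup>2 - b\<^sup>2 = 1" unfolding a_def b_def by (simp_all add: cosh_square_eq)
  have r: "cosh r = a\<^sup>2 + b\<^sup>2" "sinh r = 2 * b * a"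
    unfolding a_def b_def using cosh_add[of "r / 2" "r / 2"] sinh_add[of "r / 2" "r / 2"]
    by (simp_all add: power2_eq_square)
  have s: "s = b / a" unfolding s_def a_def b_def tanh_def ..
  have "1 - s\<^sup>2 = (a\<^sup>2 - b\<^sup>2) / a\<^sup>2" "1 + s\<^sup>2 = (a\<^sup>2 + b\<^sup>2) / a\<^sup>2"
    unfolding s power_divide using a by (simp_all add: diff_divide_distrib add_divide_distrib)
  then show "(1 + s\<^sup>2) / (1 - s\<^sup>2) = cosh r" "2 * s / (1 - s\<^sup>2) = sinh r"
    unfolding r ab using a by (simp_all add: s power2_eq_square)
qed

text \<open>The path is a segment in the coordinates \<open>ln (tanh (ri / 2))\<close>. It may pass
  through degenerate lengths, where the clamped angles take over.\<close>

lemma hyperbolic_triangle_strict_monotone: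
  fixes r1 r2 r3 r1' r2' r3' I1 I2 I3 :: real
  assumes adm: "compatible_weights I1 I2 I3"
    and r: "r1 > 0" "r2 > 0" "r3 > 0" and r': "r1' > 0" "r2' > 0" "r3' > 0"
  defines "c1 \<equiv> cosh_length I1 r2 r3" and "c2 \<equiv> cosh_length I2 r1 r3" and "c3 \<equiv> cosh_length I3 r1 r2"
    and "c1' \<equiv> cosh_length I1 r2' r3'" and "c2' \<equiv> cosh_length I2 r1' r3'" and "c3' \<equiv> cosh_length I3 r1' r2'"
    and "x1 \<equiv> ln (tanh (r1' / 2)) - ln (tanh (r1 / 2))" and "x2 \<equiv> ln (tanh (r2' / 2)) - ln (tanh (r2 / 2))"
    and "x3 \<equiv> ln (tanh (r3' / 2)) - ln (tanh (r3 / 2))"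
  assumes A: "gram_det c1 c2 c3 > 0" and x: "\<not> (x1 = 0 \<and> x2 = 0 \<and> x3 = 0)"
  shows "x1 * hyperbolic_corner c1' c2' c3' + x2 * hyperbolic_corner c2' c1' c3'
      + x3 * hyperbolic_corner c3' c1' c2'
       < x1 * hyperbolic_corner c1 c2 c3 + x2 * hyperbolic_corner c2 c1 c3 + x3 * hyperbolic_corner c3 c1 c2"
proof -
  define C S where "C = (\<lambda>s::real. (1 + s\<^sup>2) / (1 - s\<^sup>2))" and "S = (\<lambda>s::real. 2 * s / (1 - s\<^sup>2))"
  define s1 s2 s3 s1' s2' s3' where "s1 = tanh (r1 / 2)" and "s2 = tanh (r2 / 2)" and "s3 = tanh (r3 / 2)"
    and "s1' = tanh (r1' / 2)" and "s2' = tanh (r2' / 2)" and "s3' = tanh (r3' / 2)"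
  note s_defs = s1_def s2_def s3_def s1'_def s2'_def s3'_def
  have s: "0 < s1" "s1 < 1" "0 < s2" "s2 < 1" "0 < s3" "s3 < 1"
    and s': "0 < s1'" "s1' < 1" "0 < s2'" "s2' < 1" "0 < s3'" "s3' < 1"
    unfolding s_defs using r r' by (simp_all add: tanh_real_lt_1)
  have CS_half: "C (tanh (r / 2)) = cosh r" "S (tanh (r / 2)) = sinh r" for r
    unfolding C_def S_def by (rule cosh_sinh_half_tanh)+
  have x_eq: "x1 = ln s1' - ln s1" "x2 = ln s2' - ln s2" "x3 = ln s3' - ln s3"
    unfolding x1_def x2_def x3_def s_defs by simp_all
  have I: "-1 < I1" "-1 < I2" "-1 < I3" using adm unfolding compatible_weights_def by auto
  define R where "R = (\<lambda>s x t. s * exp (t * x) :: real)"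
  \<comment> \<open>The values \<open>tanh (ri / 2)\<close> stay below 1 on the segment, because their logarithms are convex
      combinations of negative numbers.\<close>
  have R01: "0 < R s (ln s' - ln s) t \<and> R s (ln s' - ln s) t < 1"
    if "0 < s" "s < 1" "0 < s'" "s' < 1" "t \<in> {0..1}" for s s' t
  proof -
    have "R s (ln s' - ln s) t = exp ((1 - t) * ln s + t * ln s')"
      unfolding R_def using that(1) by (simp add: algebra_simps exp_add exp_diff)
    moreover have "(1 - t) * ln s + t * ln s' < 0"
      using that by (cases "t = 1") (auto intro!: add_neg_nonpos mult_pos_neg mult_nonneg_nonpos)
    ultimately show ?thesis by simp
  qed
  have CS: "(C z)\<^sup>2 = (S z)\<^sup>2 + 1" "C z > 0" "S z > 0" if "0 < z" "z < 1" for z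
  proof -
    have "z^2 < 1" using that by (simp add: power_less_one_iff)
    then show "C z > 0" "S z > 0" unfolding C_def S_def using that
        by (auto intro!: divide_pos_pos add_pos_nonneg)
    from \<open>z^2 < 1\<close> show "(C z)\<^sup>2 = (S z)\<^sup>2 + 1" unfolding C_def S_def
      by (simp add: power_divide divide_simps) (simp add: algebra_simps power2_eq_square)
  qed
  have dC: "((\<lambda>t. C (R s x t)) has_real_derivative (S (R s x t))\<^sup>2 * x) (at t)"
    and dS: "((\<lambda>t. S (R s x t)) has_real_derivative S (R s x t) * C (R s x t) * x) (at t)"
    if "0 < R s x t" "R s x t < 1" for s x t
  proof -
    have ne: "1 - (R s x t)^2 \<noteq> 0" using that by (simp add: power_less_one_iff less_imp_neq)
    have dR: "(R s x has_real_derivative R s x t * x) (at t)"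
      unfolding R_def by (auto intro!: derivative_eq_intros)
    show "((\<lambda>t. C (R s x t)) has_real_derivative (S (R s x t))\<^sup>2 * x) (at t)"
      unfolding C_def S_def using ne
      by (auto intro!: derivative_eq_intros dR simp: divide_simps) (simp add: algebra_simps power2_eq_square)?
    show "((\<lambda>t. S (R s x t)) has_real_derivative S (R s x t) * C (R s x t) * x) (at t)"
      unfolding C_def S_def using ne
      by (auto intro!: derivative_eq_intros dR simp: divide_simps) (simp add: algebra_simps power2_eq_square)?
  qed
  define C1 C2 C3 S1 S2 S3 where "C1 = (\<lambda>t. C (R s1 x1 t))" and "C2 = (\<lambda>t. C (R s2 x2 t))" and "C3
      = (\<lambda>t. C (R s3 x3 t))"
    and "S1 = (\<lambda>t. S (R s1 x1 t))" and "S2 = (\<lambda>t. S (R s2 x2 t))" and "S3 = (\<lambda>t. S (R s3 x3 t))"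
  note CS_defs = C1_def C2_def C3_def S1_def S2_def S3_def
  have rr: "0 < R s1 x1 t" "R s1 x1 t < 1" "0 < R s2 x2 t" "R s2 x2 t < 1" "0 < R s3 x3 t" "R s3 x3 t < 1"
    if "t \<in> {0..1}" for t
    unfolding x_eq using R01[OF s(1,2) s'(1,2) that] R01[OF s(3,4) s'(3,4) that] R01[OF s(5,6) s'(5,6)
        that] by auto
  have CSt: "(C1 t)\<^sup>2 = (S1 t)\<^sup>2 + 1" "(C2 t)\<^sup>2 = (S2 t)\<^sup>2 + 1" "(C3 t)\<^sup>2 = (S3 t)\<^sup>2 + 1"
    "C1 t > 0" "C2 t > 0" "C3 t > 0" "S1 t > 0" "S2 t > 0" "S3 t > 0" if "t \<in> {0..1}" for t
    unfolding CS_defs using rr[OF that] CS by auto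
  have dCS: "(C1 has_real_derivative (S1 t)\<^sup>2 * x1) (at t)" "(C2 has_real_derivative (S2 t)\<^sup>2 * x2) (at t)"
    "(C3 has_real_derivative (S3 t)\<^sup>2 * x3) (at t)" "(S1 has_real_derivative S1 t * C1 t * x1) (at t)"
    "(S2 has_real_derivative S2 t * C2 t * x2) (at t)" "(S3 has_real_derivative S3 t * C3 t * x3) (at t)"
    if "t \<in> {0..1}" for t
    unfolding CS_defs using rr[OF that] by (auto intro: dC dS)
  define M1 M2 M3 where "M1 = (\<lambda>t. C2 t * C3 t + I1 * S2 t * S3 t)" and "M2 = (\<lambda>t. C1 t * C3 t
      + I2 * S1 t * S3 t)"
    and "M3 = (\<lambda>t. C1 t * C2 t + I3 * S1 t * S2 t)"
  have M: "M1 t > 1" "M2 t > 1" "M3 t > 1" if "t \<in> {0..1}" for t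
    unfolding M1_def M2_def M3_def using cosh_sinh_combination_gt_1 CSt[OF that] I by auto
  have M2: "(M1 t)\<^sup>2 - 1 > 0" "(M2 t)\<^sup>2 - 1 > 0" "(M3 t)\<^sup>2 - 1 > 0" if "t \<in> {0..1}" for t
    using M[OF that] by (simp_all add: one_less_power)
  define d1 d2 d3 where "d1 = (\<lambda>t. (M1 t*C2 t-C3 t)*x2+(M1 t*C3 t-C2 t)*x3)"
    and "d2 = (\<lambda>t. (M2 t*C1 t-C3 t)*x1+(M2 t*C3 t-C1 t)*x3)"
    and "d3 = (\<lambda>t. (M3 t*C1 t-C2 t)*x1+(M3 t*C2 t-C1 t)*x2)"
  have dM: "(M1 has_real_derivative d1 t) (at t)" "(M2 has_real_derivative d2 t) (at t)"
    "(M3 has_real_derivative d3 t) (at t)" if t: "t \<in> {0..1}" for t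
  proof -
    have *: "(A * B + J * T * U) * A - B = T\<^sup>2 * B + J * T * A * U" "(A * B + J * T * U) * B - A
        = U\<^sup>2 * A + J * T * U * B"
      if "A\<^sup>2 = T\<^sup>2 + 1" "B\<^sup>2 = U\<^sup>2 + 1" for A B J T U :: real
    proof -
      have "(A * B + J * T * U) * A - B = A\<^sup>2 * B - B + J * T * A * U" "(A * B + J * T * U) * B - A
          = B\<^sup>2 * A - A + J * T * U * B"
        by (simp_all add: algebra_simps power2_eq_square)
      then show "(A * B + J * T * U) * A - B = T\<^sup>2 * B + J * T * A * U" "(A * B + J * T * U) * B - A
          = U\<^sup>2 * A + J * T * U * B"
        unfolding that by (simp_all add: algebra_simps)
    qed
    show "(M1 has_real_derivative d1 t) (at t)" "(M2 has_real_derivative d2 t) (at t)"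
        "(M3 has_real_derivative d3 t) (at t)"
      unfolding M1_def M2_def M3_def d1_def d2_def d3_def
        *[OF CSt(2) CSt(3), OF t t] *[OF CSt(1) CSt(3), OF t t] *[OF CSt(1) CSt(2), OF t t]
      by (auto intro!: derivative_eq_intros dCS[OF t] simp: algebra_simps)
  qed
  have pos: "x1 * ((d2 t * M3 t + M2 t * d3 t - d1 t) - (M2 t * M3 t - M1 t) * (2 * M2 t * d2 t * ((M3
      t)\<^sup>2 - 1) + ((M2 t)\<^sup>2 - 1) * (2 * M3 t * d3 t)) / (2 * (((M2 t)\<^sup>2 - 1) * ((M3 t)\<^sup>2 - 1))))
     + x2 * ((d1 t * M3 t + M1 t * d3 t - d2 t) - (M1 t * M3 t - M2 t) * (2 * M1 t * d1 t * ((M3 t)\<^sup>2 -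
         1) + ((M1 t)\<^sup>2 - 1) * (2 * M3 t * d3 t)) / (2 * (((M1 t)\<^sup>2 - 1) * ((M3 t)\<^sup>2 - 1))))
     + x3 * ((d1 t * M2 t + M1 t * d2 t - d3 t) - (M1 t * M2 t - M3 t) * (2 * M1 t * d1 t * ((M2 t)\<^sup>2 -
         1) + ((M1 t)\<^sup>2 - 1) * (2 * M2 t * d2 t)) / (2 * (((M1 t)\<^sup>2 - 1) * ((M2 t)\<^sup>2 - 1)))) > 0"
    if t: "t \<in> {0..1}" and A: "gram_det (M1 t) (M2 t) (M3 t) > 0" for t
  proof -
    have coeff: "(c * D + C * d - b) - (C * D - B) * (2 * C * c * (D\<^sup>2 - 1)
        + (C\<^sup>2 - 1) * (2 * D * d)) / (2 * ((C\<^sup>2 - 1) * (D\<^sup>2 - 1)))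
        = - (b - c * ((B * C - D) / (C\<^sup>2 - 1)) - d * ((B * D - C) / (D\<^sup>2 - 1)))" if "C\<^sup>2 - 1 > 0"
            "D\<^sup>2 - 1 > 0" for b c d B C D :: real
    proof -
      have "(C * D - B) * (2 * C * c * (D\<^sup>2 - 1) + (C\<^sup>2 - 1) * (2 * D * d)) / (2 * ((C\<^sup>2 - 1) * (D\<^sup>2 - 1)))
        = (C * D - B) * C * c / (C\<^sup>2 - 1) + (C * D - B) * D * d / (D\<^sup>2 - 1)"
      proof -
        have "N * (2 * C * c * q + p * (2 * D * d)) / (2 * (p * q)) = N * C * c / p + N * D * d / q"
          if "p > 0" "q > 0" for N p q :: real using that by (simp add: field_simps)
        then show ?thesis using that .
      qed
      moreover have "(C * D - B) * C * c / (C\<^sup>2 - 1) = c * D - c * ((B * C - D) / (C\<^sup>2 - 1))"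
        using that by (simp add: field_simps power2_eq_square)
      moreover have "(C * D - B) * D * d / (D\<^sup>2 - 1) = C * d - d * ((B * D - C) / (D\<^sup>2 - 1))"
        using that by (simp add: field_simps power2_eq_square)
      ultimately show ?thesis by simp
    qed
    have "0 < hyperbolic_weight (M1 t) (M2 t) (M3 t) (C1 t) (C2 t) (C3 t)/((M1 t)^2-1)*(M1
        t*(x2^2+x3^2)-2*x2*x3)
       +hyperbolic_weight (M2 t) (M1 t) (M3 t) (C2 t) (C1 t) (C3 t)/((M2 t)^2-1)*(M2 t*(x1^2+x3^2)-2*x1*x3)
       +hyperbolic_weight (M3 t) (M1 t) (M2 t) (C3 t) (C1 t) (C2 t)/((M3 t)^2-1)*(M3 t*(x1^2+x2^2)-2*x1*x2)"
      using hyperbolic_form_pos[OF adm CSt[OF t] _ x] A unfolding M1_def M2_def M3_def by simp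
    also have "\<dots> = - (x1*(d1 t-d2 t*((M1 t*M2 t-M3 t)/((M2 t)^2-1))-d3 t*((M1 t*M3 t-M2 t)/((M3 t)^2-1)))
       + x2*(d2 t-d1 t*((M1 t*M2 t-M3 t)/((M1 t)^2-1))-d3 t*((M2 t*M3 t-M1 t)/((M3 t)^2-1)))
       + x3*(d3 t-d1 t*((M1 t*M3 t-M2 t)/((M1 t)^2-1))-d2 t*((M2 t*M3 t-M1 t)/((M2 t)^2-1))))"
      unfolding d1_def d2_def d3_def hyperbolic_angle_variation[OF M[OF t]] by simp
    finally show ?thesis
      unfolding coeff[OF M2(2) M2(3), OF t t] coeff[OF M2(1) M2(3), OF t t] coeff[OF M2(1) M2(2), OF t
          t] mult_minus_right
      by (simp only: mult.commute[of "M2 t" "M1 t"] mult.commute[of "M3 t" "M1 t"] mult.commute[of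
          "M3 t" "M2 t"])
  qed
  have R1: "R s1 x1 1 = s1'" "R s2 x2 1 = s2'" "R s3 x3 1 = s3'" "R s1 x1 0 = s1" "R s2 x2 0 = s2"
      "R s3 x3 0 = s3"
    unfolding R_def x_eq using s s' by (auto simp: exp_diff)
  have *: "x1 * clamped_arccos ((M2 1 * M3 1 - M1 1) / sqrt (((M2 1)\<^sup>2 - 1) * ((M3 1)\<^sup>2 - 1)))
    + x2 * clamped_arccos ((M1 1 * M3 1 - M2 1) / sqrt (((M1 1)\<^sup>2 - 1) * ((M3 1)\<^sup>2 - 1)))
    + x3 * clamped_arccos ((M1 1 * M2 1 - M3 1) / sqrt (((M1 1)\<^sup>2 - 1) * ((M2 1)\<^sup>2 - 1)))
     < x1 * clamped_arccos ((M2 0 * M3 0 - M1 0) / sqrt (((M2 0)\<^sup>2 - 1) * ((M3 0)\<^sup>2 - 1)))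
    + x2 * clamped_arccos ((M1 0 * M3 0 - M2 0) / sqrt (((M1 0)\<^sup>2 - 1) * ((M3 0)\<^sup>2 - 1)))
    + x3 * clamped_arccos ((M1 0 * M2 0 - M3 0) / sqrt (((M1 0)\<^sup>2 - 1) * ((M2 0)\<^sup>2 - 1)))"
  proof (rule weighted_angle_sum_decreases[where
        N1' = "\<lambda>t. d2 t * M3 t + M2 t * d3 t - d1 t" and N2' = "\<lambda>t. d1 t * M3 t + M1 t * d3 t - d2 t" and
        N3' = "\<lambda>t. d1 t * M2 t + M1 t * d2 t - d3 t" and
        s1' = "\<lambda>t. 2 * M2 t * d2 t * ((M3 t)\<^sup>2 - 1) + ((M2 t)\<^sup>2 - 1) * (2 * M3 t * d3 t)" and
        s2' = "\<lambda>t. 2 * M1 t * d1 t * ((M3 t)\<^sup>2 - 1) + ((M1 t)\<^sup>2 - 1) * (2 * M3 t * d3 t)" and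
        s3' = "\<lambda>t. 2 * M1 t * d1 t * ((M2 t)\<^sup>2 - 1) + ((M1 t)\<^sup>2 - 1) * (2 * M2 t * d2 t)" and
        \<Delta> = "\<lambda>t. gram_det (M1 t) (M2 t) (M3 t)"])
    show "gram_det (M1 0) (M2 0) (M3 0) > 0"
      using A unfolding M1_def M2_def M3_def CS_defs R1 unfolding s_defs CS_half
        c1_def c2_def c3_def cosh_length_def .
    fix t :: real assume t: "t \<in> {0..1}"
    show "((\<lambda>t. M2 t * M3 t - M1 t) has_real_derivative d2 t * M3 t + M2 t * d3 t - d1 t) (at t)"
      "((\<lambda>t. M1 t * M3 t - M2 t) has_real_derivative d1 t * M3 t + M1 t * d3 t - d2 t) (at t)"
      "((\<lambda>t. M1 t * M2 t - M3 t) has_real_derivative d1 t * M2 t + M1 t * d2 t - d3 t) (at t)"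
      "((\<lambda>t. ((M2 t)\<^sup>2 - 1) * ((M3 t)\<^sup>2 - 1)) has_real_derivative
         2 * M2 t * d2 t * ((M3 t)\<^sup>2 - 1) + ((M2 t)\<^sup>2 - 1) * (2 * M3 t * d3 t)) (at t)"
      "((\<lambda>t. ((M1 t)\<^sup>2 - 1) * ((M3 t)\<^sup>2 - 1)) has_real_derivative
         2 * M1 t * d1 t * ((M3 t)\<^sup>2 - 1) + ((M1 t)\<^sup>2 - 1) * (2 * M3 t * d3 t)) (at t)"
      "((\<lambda>t. ((M1 t)\<^sup>2 - 1) * ((M2 t)\<^sup>2 - 1)) has_real_derivative
         2 * M1 t * d1 t * ((M2 t)\<^sup>2 - 1) + ((M1 t)\<^sup>2 - 1) * (2 * M2 t * d2 t)) (at t)"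
      by (auto intro!: derivative_eq_intros dM[OF t] simp: algebra_simps)
    show "((M2 t)\<^sup>2 - 1) * ((M3 t)\<^sup>2 - 1) > 0 \<and> ((M1 t)\<^sup>2 - 1) * ((M3 t)\<^sup>2 - 1) > 0 \<and> ((M1 t)\<^sup>2 - 1) *
        ((M2 t)\<^sup>2 - 1) > 0"
      by (intro conjI mult_pos_pos M2 t)
    show "((M2 t)\<^sup>2 - 1) * ((M3 t)\<^sup>2 - 1) - (M2 t * M3 t - M1 t)\<^sup>2 = gram_det (M1 t) (M2 t) (M3 t) \<and>
      ((M1 t)\<^sup>2 - 1) * ((M3 t)\<^sup>2 - 1) - (M1 t * M3 t - M2 t)\<^sup>2 = gram_det (M1 t) (M2 t) (M3 t) \<and>
      ((M1 t)\<^sup>2 - 1) * ((M2 t)\<^sup>2 - 1) - (M1 t * M2 t - M3 t)\<^sup>2 = gram_det (M1 t) (M2 t) (M3 t)"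
      unfolding gram_det_def by (simp add: algebra_simps power2_eq_square)
  qed (rule pos)
  show ?thesis
    using * unfolding hyperbolic_corner_def M1_def M2_def M3_def CS_defs R1
    unfolding s_defs CS_half c1_def c2_def c3_def c1'_def c2'_def c3'_def cosh_length_def .
qed

section \<open>Inner angles of Euclidean faces\<close>

lemma euclidean_angle_cosine_law:
  "euclidean_angle A B C = arccos (((dist A B)\<^sup>2 + (dist A C)\<^sup>2 - (dist B C)\<^sup>2) / (2 * dist A B * dist A C))"
proof -
  have "(B - A) \<bullet> (C - A) = ((dist A B)\<^sup>2 + (dist A C)\<^sup>2 - (dist B C)\<^sup>2) / 2"
    by (simp add: dot_norm_neg dist_norm norm_minus_commute)
  then show ?thesis
    unfolding euclidean_angle_def
    by (simp only: dist_norm norm_minus_commute[of B A] norm_minus_commute[of C A]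
        divide_divide_eq_left mult.assoc)
qed

lemma heron_factor: "heron (a\<^sup>2) (b\<^sup>2) (c\<^sup>2) = (a + b + c) * (b + c - a) * (a + c - b) * (a + b - c)"
  unfolding heron_def by (simp add: algebra_simps power2_eq_square)

lemma euclidean_triangle_exists:
  fixes a b c :: real
  assumes pos: "a > 0" "b > 0" "c > 0" and tri: "a < b + c" "b < a + c" "c < a + b"
  obtains A B C :: "real^2" where "dist A B = c" "dist A C = b" "dist B C = a"
proof -
  define z where "z = (b\<^sup>2 + c\<^sup>2 - a\<^sup>2) / (2 * b * c)"
  have "(2 * b * c)\<^sup>2 - (b\<^sup>2 + c\<^sup>2 - a\<^sup>2)\<^sup>2 = (a + b + c) * (b + c - a) * (a + c - b) * (a + b - c)"
    by (simp add: algebra_simps power2_eq_square)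
  also have "\<dots> > 0" using pos tri by simp
  finally have "(b\<^sup>2 + c\<^sup>2 - a\<^sup>2)\<^sup>2 < (2 * b * c)\<^sup>2" by simp
  then have "z\<^sup>2 \<le> 1" unfolding z_def power_divide using pos by simp
  define y where "y = sqrt (1 - z\<^sup>2)"
  have y: "y\<^sup>2 = 1 - z\<^sup>2" unfolding y_def using \<open>z\<^sup>2 \<le> 1\<close> by simp
  have bcz: "2 * b * c * z = b\<^sup>2 + c\<^sup>2 - a\<^sup>2" unfolding z_def using pos by simp
  define A B C :: "real^2" where "A = 0" and "B = vector [c, 0]" and "C = vector [b * z, b * y]"
  have "dist A B = c" "dist A C = sqrt ((b * z)\<^sup>2 + (b * y)\<^sup>2)" "dist B C = sqrt ((c - b * z)\<^sup>2 + (b * y)\<^sup>2)"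
    unfolding A_def B_def C_def dist_norm norm_vec_def L2_set_def sum_2 using pos by simp_all
  moreover have "(b * z)\<^sup>2 + (b * y)\<^sup>2 = b\<^sup>2"
    unfolding power_mult_distrib y by (simp add: algebra_simps)
  moreover have "(c - b * z)\<^sup>2 + (b * y)\<^sup>2 = a\<^sup>2"
  proof -
    have "(c - b * z)\<^sup>2 + (b * y)\<^sup>2 = c\<^sup>2 - 2 * b * c * z + b\<^sup>2 * z\<^sup>2 + b\<^sup>2 * y\<^sup>2"
      by (simp add: algebra_simps power2_eq_square)
    also have "\<dots> = a\<^sup>2" unfolding y bcz by (simp add: algebra_simps)
    finally show ?thesis .
  qed
  ultimately show thesis using that[of A B C] pos by simp
qed

text \<open>The cosine law shows that every realization of the face has the same angle; the explicit triangle
  shows that there is one.\<close>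

lemma euclidean_inner_angle_eq:
  assumes f: "f = {i, j, k}" "distinct [i, j, k]" and sym: "l k j = l j k"
    and pos: "l j k > 0" "l i k > 0" "l i j > 0"
    and tri: "l j k < l i k + l i j" "l i k < l j k + l i j" "l i j < l j k + l i k"
  shows "euclidean_inner_angle l i f = arccos (((l i j)\<^sup>2 + (l i k)\<^sup>2 - (l j k)\<^sup>2) / (2 * l i j * l i k))"
  unfolding euclidean_inner_angle_def
proof (rule the_equality)
  obtain A B C :: "real^2" where "dist A B = l i j" "dist A C = l i k" "dist B C = l j k"
    using euclidean_triangle_exists[OF pos tri] .
  then show "\<exists>j' k' A B C. f = {i, j', k'} \<and> distinct [i, j', k'] \<and> dist A B = l i j' \<and> dist A C = l i k' \<and>
      dist B C = l j' k' \<and> arccos (((l i j)\<^sup>2 + (l i k)\<^sup>2 - (l j k)\<^sup>2) / (2 * l i j * l i k))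
          = euclidean_angle A B C"
    using f by (intro exI[of _ j] exI[of _ k] exI[of _ A] exI[of _ B] exI[of _ C]) (simp add:
        euclidean_angle_cosine_law)
next
  fix \<theta>
  assume "\<exists>j' k' A B C. f = {i, j', k'} \<and> distinct [i, j', k'] \<and> dist A B = l i j' \<and> dist A C = l i k' \<and>
      dist B C = l j' k' \<and> \<theta> = euclidean_angle A B C"
  then obtain j' k' and A B C :: "real^2" where *: "f = {i, j', k'}" "distinct [i, j', k']"
    "dist A B = l i j'" "dist A C = l i k'" "dist B C = l j' k'" "\<theta> = euclidean_angle A B C" by blast
  have "(j' = j \<and> k' = k) \<or> (j' = k \<and> k' = j)" using f *(1,2) by (auto simp: insert_eq_iff doubleton_eq_iff)
  then show "\<theta> = arccos (((l i j)\<^sup>2 + (l i k)\<^sup>2 - (l j k)\<^sup>2) / (2 * l i j * l i k))"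
    unfolding *(6) euclidean_angle_cosine_law *(3-5) using sym by (auto simp: algebra_simps)
qed

lemma euclidean_length_commute: "euclidean_length I r a b = euclidean_length I r b a"
  unfolding euclidean_length_def by (simp add: insert_commute algebra_simps)

lemma euclidean_length_eq: "euclidean_length I r a b = sqrt (sq_length (I {a, b}) (r a) (r b))"
  unfolding euclidean_length_def sq_length_def by (simp add: algebra_simps)

text \<open>For a packing metric the strict triangle inequalities make the clamping invisible.\<close>

lemma euclidean_packing_inner_angle:
  assumes f: "f = {i, j, k}" "distinct [i, j, k]"
    and I: "-1 < I {i, j}" "-1 < I {i, k}" "-1 < I {j, k}" and r: "0 < r i" "0 < r j" "0 < r k"
    and tri: "strict_triangle_inequalities F (euclidean_length I r)" "f \<in> F"
  defines "L1 \<equiv> sq_length (I {j, k}) (r j) (r k)" and "L2 \<equiv> sq_length (I {i, k}) (r i) (r k)"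
    and "L3 \<equiv> sq_length (I {i, j}) (r i) (r j)"
  shows "euclidean_inner_angle (euclidean_length I r) i f = euclidean_corner L1 L2 L3" "heron L1 L2 L3 > 0"
proof -
  define l where "l = euclidean_length I r"
  have L: "L1 > 0" "L2 > 0" "L3 > 0" unfolding L1_def L2_def L3_def using I r by (simp_all add: sq_length_pos)
  have l: "l j k = sqrt L1" "l i k = sqrt L2" "l i j = sqrt L3"
    unfolding l_def euclidean_length_eq L1_def L2_def L3_def by simp_all
  have lpos: "l j k > 0" "l i k > 0" "l i j > 0" unfolding l using L by simp_all
  have l2: "L1 = (l j k)\<^sup>2" "L2 = (l i k)\<^sup>2" "L3 = (l i j)\<^sup>2" unfolding l using L by simp_all
  have sym: "l a b = l b a" for a b unfolding l_def by (rule euclidean_length_commute)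
  have t: "l j k < l i k + l i j" "l i k < l j k + l i j" "l i j < l j k + l i k"
    using tri f(1) sym unfolding strict_triangle_inequalities_def l_def[symmetric]
    by (metis add.commute)+
  show heron: "heron L1 L2 L3 > 0" unfolding l2 heron_factor using lpos t by simp
  have "euclidean_inner_angle l i f = arccos ((L3 + L2 - L1) / (2 * l i j * l i k))"
    unfolding euclidean_inner_angle_eq[OF f sym lpos t] l2 ..
  also have "2 * l i j * l i k = sqrt (4 * L2 * L3)" unfolding l real_sqrt_mult by simp
  also have "arccos ((L3 + L2 - L1) / sqrt (4 * L2 * L3)) = euclidean_corner L1 L2 L3"
  proof -
    have "(L2 + L3 - L1)\<^sup>2 < 4 * L2 * L3" using heron unfolding heron_def
        by (simp add: algebra_simps power2_eq_square)
    then have "\<bar>(L2 + L3 - L1) / sqrt (4 * L2 * L3)\<bar> < 1" using abs_quotient_sqrt_less_1 L by simp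
    then show ?thesis unfolding euclidean_corner_def by (simp add: clamped_arccos_eq add.commute)
  qed
  finally show "euclidean_inner_angle (euclidean_length I r) i f = euclidean_corner L1 L2 L3"
      unfolding l_def .
qed

lemma euclidean_corner_scale:
  assumes "m > 0" shows "euclidean_corner (m\<^sup>2 * L1) (m\<^sup>2 * L2) (m\<^sup>2 * L3) = euclidean_corner L1 L2 L3"
proof -
  have "sqrt (4 * (m\<^sup>2 * L2) * (m\<^sup>2 * L3)) = sqrt ((m\<^sup>2)\<^sup>2 * (4 * L2 * L3))"
    by (simp add: algebra_simps power2_eq_square)
  also have "\<dots> = m\<^sup>2 * sqrt (4 * L2 * L3)" by (simp only: real_sqrt_mult real_sqrt_abs abs_power2)
  finally have "sqrt (4 * (m\<^sup>2 * L2) * (m\<^sup>2 * L3)) = m\<^sup>2 * sqrt (4 * L2 * L3)" .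
  then have "(m\<^sup>2 * L2 + m\<^sup>2 * L3 - m\<^sup>2 * L1) / sqrt (4 * (m\<^sup>2 * L2) * (m\<^sup>2 * L3))
     = (m\<^sup>2 * (L2 + L3 - L1)) / (m\<^sup>2 * sqrt (4 * L2 * L3))" by (simp add: algebra_simps)
  also have "\<dots> = (L2 + L3 - L1) / sqrt (4 * L2 * L3)" using assms by (intro mult_divide_mult_cancel_left) simp
  finally show ?thesis unfolding euclidean_corner_def by simp
qed

lemma sq_length_scale: "sq_length I (m * a) (m * b) = m\<^sup>2 * sq_length I a b"
  unfolding sq_length_def by (simp add: algebra_simps power2_eq_square)

text \<open>If \<open>ln r' - ln r\<close> is constant on the face, then the metrics are proportional there and all angles
  agree; otherwise \<open>euclidean_triangle_strict_monotone\<close> gives a strict inequality.\<close>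

lemma euclidean_face_comparison:
  assumes f: "f \<in> F" "card f = 3"
    and I: "\<And>i j k. f = {i, j, k} \<Longrightarrow> distinct [i, j, k] \<Longrightarrow> compatible_weights (I {j, k}) (I {i, k}) (I {i, j})"
    and r: "\<And>v. v \<in> f \<Longrightarrow> 0 < r v" "strict_triangle_inequalities F (euclidean_length I r)"
    and r': "\<And>v. v \<in> f \<Longrightarrow> 0 < r' v" "strict_triangle_inequalities F (euclidean_length I r')"
  defines "D \<equiv> \<Sum>v\<in>f. (ln (r' v) - ln (r v)) *
      (euclidean_inner_angle (euclidean_length I r') v f - euclidean_inner_angle (euclidean_length I r) v f)"
  shows "D \<le> 0" and "D = 0 \<Longrightarrow> v \<in> f \<Longrightarrow> w \<in> f \<Longrightarrow> ln (r' v) - ln (r v) = ln (r' w) - ln (r w)"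
proof -
  obtain i j k where ijk: "f = {i, j, k}" "i \<noteq> j" "i \<noteq> k" "j \<noteq> k"
    using f(2) by (auto simp: card_3_iff)
  have perm: "f = {i, j, k}" "distinct [i, j, k]" "f = {j, i, k}" "distinct [j, i, k]" "f = {k, i, j}"
      "distinct [k, i, j]"
    using ijk by auto
  have adm: "compatible_weights (I {j, k}) (I {i, k}) (I {i, j})" using I[OF perm(1,2)] .
  then have Igt: "-1 < I {i, j}" "-1 < I {i, k}" "-1 < I {j, k}" unfolding compatible_weights_def by auto
  define x where "x = (\<lambda>v. ln (r' v) - ln (r v))"
  define L where "L = (\<lambda>r a b. sq_length (I {a, b}) (r a) (r b))"
  have Lsym: "L r a b = L r b a" for r a b
    unfolding L_def by (simp add: insert_commute sq_length_commute)
  have pos: "0 < r i" "0 < r j" "0 < r k" "0 < r' i" "0 < r' j" "0 < r' k" using r(1) r'(1) ijk(1) by auto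
  have ang: "euclidean_inner_angle (euclidean_length I q) i f
      = euclidean_corner (L q j k) (L q i k) (L q i j)"
    "euclidean_inner_angle (euclidean_length I q) j f = euclidean_corner (L q i k) (L q j k) (L q i j)"
    "euclidean_inner_angle (euclidean_length I q) k f = euclidean_corner (L q i j) (L q j k) (L q i k)"
    and heron: "heron (L q j k) (L q i k) (L q i j) > 0"
    if q: "0 < q i" "0 < q j" "0 < q k" "strict_triangle_inequalities F (euclidean_length I q)" for q
  proof -
    note I' = Igt Igt[unfolded insert_commute[of i j] insert_commute[of i k] insert_commute[of j k]]
    show "euclidean_inner_angle (euclidean_length I q) i f = euclidean_corner (L q j k) (L q i k) (L q i j)"
      "heron (L q j k) (L q i k) (L q i j) > 0"
      unfolding L_def using euclidean_packing_inner_angle[OF perm(1,2) _ _ _ _ _ _ q(4) f(1)] q Igt by auto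
    show "euclidean_inner_angle (euclidean_length I q) j f = euclidean_corner (L q i k) (L q j k) (L q i j)"
      using euclidean_packing_inner_angle(1)[OF perm(3,4) _ _ _ _ _ _ q(4) f(1)] q I'
      unfolding Lsym[of q i j] unfolding L_def by auto
    show "euclidean_inner_angle (euclidean_length I q) k f = euclidean_corner (L q i j) (L q j k) (L q i k)"
      using euclidean_packing_inner_angle(1)[OF perm(5,6) _ _ _ _ _ _ q(4) f(1)] q I'
      unfolding Lsym[of q j k] Lsym[of q i k] unfolding L_def by auto
  qed
  note ang_r = ang[OF pos(1-3) r(2)] and ang_r' = ang[OF pos(4-6) r'(2)]
  have D: "D = (x i * euclidean_corner (L r' j k) (L r' i k) (L r' i j)
      + x j * euclidean_corner (L r' i k) (L r' j k) (L r' i j)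
      + x k * euclidean_corner (L r' i j) (L r' j k) (L r' i k))
    - (x i * euclidean_corner (L r j k) (L r i k) (L r i j) + x j * euclidean_corner (L r i k) (L r j
        k) (L r i j)
      + x k * euclidean_corner (L r i j) (L r j k) (L r i k))"
    unfolding D_def x_def ang_r[symmetric] ang_r'[symmetric] using ijk(2-4)
    by (simp add: ijk(1) algebra_simps)
  have strict: "D < 0" if "\<not> (x i = x j \<and> x i = x k)"
    using euclidean_triangle_strict_monotone[OF adm pos heron[OF pos(1-3) r(2), unfolded L_def]
        that[unfolded x_def]]
    unfolding D x_def L_def by simp
  show "D \<le> 0"
  proof (cases "x i = x j \<and> x i = x k")
    case True
    \<comment> \<open>The two metrics on \<open>f\<close> are proportional, so the angles agree.\<close>
    define m where "m = exp (x i)"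
    have "r' v = m * r v" if "v \<in> {i, j, k}" for v
      using that True pos unfolding m_def x_def by (auto simp: exp_diff) (metis exp_diff exp_ln
          mult.commute nonzero_mult_div_cancel_left times_divide_eq_right less_irrefl)+
    then have "L r' a b = m\<^sup>2 * L r a b" if "a \<in> {i, j, k}" "b \<in> {i, j, k}" for a b
      using that unfolding L_def by (simp only: sq_length_scale)
    then have "D = 0" unfolding D by (simp add: euclidean_corner_scale m_def)
    then show ?thesis by simp
  qed (use strict in simp)
  show "ln (r' v) - ln (r v) = ln (r' w) - ln (r w)" if "D = 0" "v \<in> f" "w \<in> f"
  proof -
    have "x i = x j \<and> x i = x k" using strict that(1) by (metis less_irrefl)
    then have "x v = x w" using that(2,3) ijk(1) by auto
    then show ?thesis unfolding x_def .
  qed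
qed

section \<open>Inner angles of hyperbolic faces\<close>

text \<open>The reversed Cauchy-Schwarz inequality. It guarantees that \<open>arcosh\<close> is applied inside its
  domain in the definition of the distance.\<close>

lemma neg_lorentz_ge_1:
  assumes "p \<in> hyperbolic_plane" "q \<in> hyperbolic_plane"
  shows "- lorentz p q \<ge> 1"
proof -
  have p: "(fst p)\<^sup>2 = 1 + (norm (snd p))\<^sup>2" "fst p > 0" and q: "(fst q)\<^sup>2 = 1 + (norm (snd q))\<^sup>2" "fst q > 0"
    using assms unfolding hyperbolic_plane_def lorentz_def
    unfolding power2_norm_eq_inner by (auto simp: power2_eq_square)
  have "(fst p * fst q)\<^sup>2 = (1 + norm (snd p) * norm (snd q))\<^sup>2 + (norm (snd p) - norm (snd q))\<^sup>2"
    unfolding power_mult_distrib p q by (simp add: algebra_simps power2_eq_square)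
  then have "(1 + norm (snd p) * norm (snd q))\<^sup>2 \<le> (fst p * fst q)\<^sup>2" by simp
  then have "1 + norm (snd p) * norm (snd q) \<le> fst p * fst q"
    by (rule power2_le_imp_le) (use p q in simp)
  then show ?thesis using norm_cauchy_schwarz[of "snd p" "snd q"] unfolding lorentz_def by simp
qed

lemma cosh_hyperbolic_dist:
  "p \<in> hyperbolic_plane \<Longrightarrow> q \<in> hyperbolic_plane \<Longrightarrow> cosh (hyperbolic_dist p q) = - lorentz p q"
  unfolding hyperbolic_dist_def using neg_lorentz_ge_1 by simp

lemma lorentz_bilinear:
  "lorentz (p + a *\<^sub>R x) (q + b *\<^sub>R y) = lorentz p q + b * lorentz p y + a * lorentz x q
      + a * b * lorentz x y"
  unfolding lorentz_def by (simp add: inner_add_left inner_add_right algebra_simps)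

lemma lorentz_commute: "lorentz p q = lorentz q p"
  unfolding lorentz_def by (simp add: inner_commute mult.commute)

lemma hyperbolic_angle_cosine_law:
  assumes "A \<in> hyperbolic_plane" "B \<in> hyperbolic_plane" "C \<in> hyperbolic_plane"
    and c: "hyperbolic_dist A B = c" "c \<ge> 0" and b: "hyperbolic_dist A C = b" "b \<ge> 0" and a:
        "hyperbolic_dist B C = a"
  shows "hyperbolic_angle A B C = arccos ((cosh b * cosh c - cosh a) / (sinh c * sinh b))"
proof -
  have AA: "lorentz A A = -1" "lorentz B B = -1" "lorentz C C = -1"
    using assms(1-3) unfolding hyperbolic_plane_def by auto
  have L: "lorentz A B = - cosh c" "lorentz A C = - cosh b" "lorentz B C = - cosh a"
    using cosh_hyperbolic_dist assms(1-3) unfolding c(1)[symmetric] b(1)[symmetric] a(1)[symmetric] by auto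
  have "lorentz (hyperbolic_direction A B) (hyperbolic_direction A B) = (sinh c)\<^sup>2"
    "lorentz (hyperbolic_direction A C) (hyperbolic_direction A C) = (sinh b)\<^sup>2"
    "lorentz (hyperbolic_direction A B) (hyperbolic_direction A C) = cosh b * cosh c - cosh a"
    unfolding hyperbolic_direction_def lorentz_bilinear sinh_square_eq
    unfolding lorentz_commute[of B A] lorentz_commute[of C A] AA L by (simp_all add: power2_eq_square)
  then show ?thesis unfolding hyperbolic_angle_def Let_def using b(2) c(2) by simp
qed

text \<open>In this form the determinant is visibly positive under the strict triangle inequalities.\<close>

lemma gram_det_cosh:
  fixes a b c :: real
  shows "gram_det (cosh a) (cosh b) (cosh c) = (cosh (b + c) - cosh a) * (cosh a - cosh (b - c))"
proof -
  have "(cosh (b + c) - cosh a) * (cosh a - cosh (b - c)) = (sinh b)\<^sup>2 * (sinh c)\<^sup>2 - (cosh a - cosh b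
      * cosh c)\<^sup>2"
    unfolding cosh_add cosh_diff by (simp add: algebra_simps power2_eq_square)
  then show ?thesis unfolding gram_det_def sinh_square_eq by (simp add: algebra_simps power2_eq_square)
qed

lemma gram_det_cosh_pos:
  fixes a b c :: real
  assumes pos: "a > 0" "b > 0" "c > 0" and tri: "a < b + c" "b < a + c" "c < a + b"
  shows "gram_det (cosh a) (cosh b) (cosh c) > 0"
proof -
  have "cosh a < cosh (b + c)" using pos tri by (simp add: cosh_real_strict_mono)
  moreover have "cosh (b - c) < cosh a"
    using cosh_real_strict_mono[of "\<bar>b - c\<bar>" a] tri by simp
  ultimately show ?thesis unfolding gram_det_cosh by simp
qed

lemma hyperbolic_triangle_exists:
  fixes a b c :: real
  assumes pos: "a > 0" "b > 0" "c > 0" and tri: "a < b + c" "b < a + c" "c < a + b"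
  obtains A B C where "A \<in> hyperbolic_plane" "B \<in> hyperbolic_plane" "C \<in> hyperbolic_plane"
     "hyperbolic_dist A B = c" "hyperbolic_dist A C = b" "hyperbolic_dist B C = a"
proof -
  define z where "z = (cosh b * cosh c - cosh a) / (sinh b * sinh c)"
  have sh: "sinh b > 0" "sinh c > 0" using pos by simp_all
  have "(sinh b * sinh c)\<^sup>2 - (cosh b * cosh c - cosh a)\<^sup>2 = gram_det (cosh a) (cosh b) (cosh c)"
    unfolding gram_det_def power_mult_distrib sinh_square_eq by (simp add: algebra_simps power2_eq_square)
  then have "(cosh b * cosh c - cosh a)\<^sup>2 < (sinh b * sinh c)\<^sup>2" using gram_det_cosh_pos[OF assms] by simp
  then have "z\<^sup>2 \<le> 1" unfolding z_def power_divide using sh by simp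
  define y where "y = sqrt (1 - z\<^sup>2)"
  have y: "y\<^sup>2 = 1 - z\<^sup>2" unfolding y_def using \<open>z\<^sup>2 \<le> 1\<close> by simp
  have bcz: "sinh b * sinh c * z = cosh b * cosh c - cosh a" unfolding z_def using sh by simp
  define A B C :: "real \<times> (real^2)" where "A = (1, 0)" and "B = (cosh c, vector [sinh c, 0])"
    and "C = (cosh b, vector [sinh b * z, sinh b * y])"
  have L: "lorentz A A = -1" "lorentz B B = (sinh c)\<^sup>2 - (cosh c)\<^sup>2"
    "lorentz C C = (sinh b)\<^sup>2 * (z\<^sup>2 + y\<^sup>2) - (cosh b)\<^sup>2"
    "lorentz A B = - cosh c" "lorentz A C = - cosh b" "lorentz B C = sinh b * sinh c * z - cosh b * cosh c"
    unfolding A_def B_def C_def lorentz_def inner_vec_def sum_2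
    by (simp_all add: algebra_simps power2_eq_square)
  have "A \<in> hyperbolic_plane" "B \<in> hyperbolic_plane" "C \<in> hyperbolic_plane"
    unfolding hyperbolic_plane_def mem_Collect_eq L y by (simp_all add: A_def B_def C_def sinh_square_eq)
  moreover have "hyperbolic_dist A B = c" "hyperbolic_dist A C = b" "hyperbolic_dist B C = a"
    unfolding hyperbolic_dist_def L bcz using pos by (simp_all add: arcosh_cosh_real)
  ultimately show thesis using that by blast
qed

lemma hyperbolic_inner_angle_eq:
  assumes f: "f = {i, j, k}" "distinct [i, j, k]" and sym: "l k j = l j k"
    and pos: "l j k > 0" "l i k > 0" "l i j > 0"
    and tri: "l j k < l i k + l i j" "l i k < l j k + l i j" "l i j < l j k + l i k"
  shows "hyperbolic_inner_angle l i f
       = arccos ((cosh (l i j) * cosh (l i k) - cosh (l j k)) / (sinh (l i j) * sinh (l i k)))" (is "_ = ?th")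
  unfolding hyperbolic_inner_angle_def
proof (rule the_equality)
  obtain A B C where *: "A \<in> hyperbolic_plane" "B \<in> hyperbolic_plane" "C \<in> hyperbolic_plane"
     "hyperbolic_dist A B = l i j" "hyperbolic_dist A C = l i k" "hyperbolic_dist B C = l j k"
    using hyperbolic_triangle_exists[OF pos tri] .
  have "?th = hyperbolic_angle A B C"
    unfolding hyperbolic_angle_cosine_law[OF *(1-4) less_imp_le[OF pos(3)] *(5) less_imp_le[OF pos(2)] *(6)]
    by (simp add: mult.commute)
  with * f show "\<exists>j k. f = {i, j, k} \<and> distinct [i, j, k] \<and>
        (\<exists>A \<in> hyperbolic_plane. \<exists>B \<in> hyperbolic_plane. \<exists>C \<in> hyperbolic_plane.
          hyperbolic_dist A B = l i j \<and> hyperbolic_dist A C = l i k \<and>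
          hyperbolic_dist B C = l j k \<and> ?th = hyperbolic_angle A B C)"
    by (intro exI[of _ j] exI[of _ k] conjI bexI[of _ A] bexI[of _ B] bexI[of _ C])
next
  fix \<theta>
  assume "\<exists>j k. f = {i, j, k} \<and> distinct [i, j, k] \<and>
        (\<exists>A \<in> hyperbolic_plane. \<exists>B \<in> hyperbolic_plane. \<exists>C \<in> hyperbolic_plane.
          hyperbolic_dist A B = l i j \<and> hyperbolic_dist A C = l i k \<and>
          hyperbolic_dist B C = l j k \<and> \<theta> = hyperbolic_angle A B C)"
  then obtain j' k' A B C where *: "f = {i, j', k'}" "distinct [i, j', k']"
    "A \<in> hyperbolic_plane" "B \<in> hyperbolic_plane" "C \<in> hyperbolic_plane"
    "hyperbolic_dist A B = l i j'" "hyperbolic_dist A C = l i k'" "hyperbolic_dist B C = l j' k'"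
    "\<theta> = hyperbolic_angle A B C" by blast
  have jk: "(j' = j \<and> k' = k) \<or> (j' = k \<and> k' = j)" using f *(1,2)
      by (auto simp: insert_eq_iff doubleton_eq_iff)
  then have "l i j' \<ge> 0" "l i k' \<ge> 0" using pos by auto
  then have "\<theta> = arccos ((cosh (l i k') * cosh (l i j') - cosh (l j' k')) / (sinh (l i j') * sinh (l i k')))"
    unfolding *(9) using hyperbolic_angle_cosine_law[OF *(3-6) _ *(7) _ *(8)] by simp
  then show "\<theta> = ?th" using jk sym by (auto simp: mult.commute)
qed

lemma hyperbolic_length_commute: "hyperbolic_length I r a b = hyperbolic_length I r b a"
  unfolding hyperbolic_length_def by (simp add: insert_commute algebra_simps)

lemma cosh_length_commute: "cosh_length I a b = cosh_length I b a"
  unfolding cosh_length_def by (simp add: algebra_simps)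

lemma cosh_length_gt_1:
  assumes "-1 < I" "0 < a" "0 < b" shows "1 < cosh_length I a b"
  unfolding cosh_length_def using assms by (intro cosh_sinh_combination_gt_1) (simp_all add: cosh_square_eq)

lemma hyperbolic_packing_inner_angle:
  assumes f: "f = {i, j, k}" "distinct [i, j, k]"
    and I: "-1 < I {i, j}" "-1 < I {i, k}" "-1 < I {j, k}" and r: "0 < r i" "0 < r j" "0 < r k"
    and tri: "strict_triangle_inequalities F (hyperbolic_length I r)" "f \<in> F"
  defines "c1 \<equiv> cosh_length (I {j, k}) (r j) (r k)" and "c2 \<equiv> cosh_length (I {i, k}) (r i) (r k)"
    and "c3 \<equiv> cosh_length (I {i, j}) (r i) (r j)"
  shows "hyperbolic_inner_angle (hyperbolic_length I r) i f = hyperbolic_corner c1 c2 c3"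
      "gram_det c1 c2 c3 > 0"
proof -
  define l where "l = hyperbolic_length I r"
  have c: "c1 > 1" "c2 > 1" "c3 > 1" unfolding c1_def c2_def c3_def using I r
      by (simp_all add: cosh_length_gt_1)
  have l: "l j k = arcosh c1" "l i k = arcosh c2" "l i j = arcosh c3"
    unfolding l_def hyperbolic_length_def c1_def c2_def c3_def cosh_length_def by simp_all
  have lpos: "l j k > 0" "l i k > 0" "l i j > 0" unfolding l using c by simp_all
  have lc: "c1 = cosh (l j k)" "c2 = cosh (l i k)" "c3 = cosh (l i j)" unfolding l using c by simp_all
  have sym: "l a b = l b a" for a b unfolding l_def by (rule hyperbolic_length_commute)
  have t: "l j k < l i k + l i j" "l i k < l j k + l i j" "l i j < l j k + l i k"
    using tri f(1) sym unfolding strict_triangle_inequalities_def l_def[symmetric]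
    by (metis add.commute)+
  show gram: "gram_det c1 c2 c3 > 0" unfolding lc using lpos t by (intro gram_det_cosh_pos) auto
  have "hyperbolic_inner_angle l i f = arccos ((c3 * c2 - c1) / (sinh (l i j) * sinh (l i k)))"
    unfolding hyperbolic_inner_angle_eq[OF f sym lpos t] lc ..
  also have "sinh (l i j) * sinh (l i k) = sqrt ((c2\<^sup>2 - 1) * (c3\<^sup>2 - 1))"
    unfolding lc sinh_square_eq[symmetric] real_sqrt_mult using lpos by simp
  also have "arccos ((c3 * c2 - c1) / sqrt ((c2\<^sup>2 - 1) * (c3\<^sup>2 - 1))) = hyperbolic_corner c1 c2 c3"
  proof -
    have "(c2 * c3 - c1)\<^sup>2 < (c2\<^sup>2 - 1) * (c3\<^sup>2 - 1)" using gram unfolding gram_det_def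
        by (simp add: algebra_simps power2_eq_square)
    moreover have "(c2\<^sup>2 - 1) * (c3\<^sup>2 - 1) > 0" using c by (simp add: one_less_power)
    ultimately have "\<bar>(c2 * c3 - c1) / sqrt ((c2\<^sup>2 - 1) * (c3\<^sup>2 - 1))\<bar> < 1"
        using abs_quotient_sqrt_less_1 by blast
    then show ?thesis unfolding hyperbolic_corner_def by (simp add: clamped_arccos_eq mult.commute)
  qed
  finally show "hyperbolic_inner_angle (hyperbolic_length I r) i f
      = hyperbolic_corner c1 c2 c3" unfolding l_def .
qed

lemma hyperbolic_face_comparison:
  assumes f: "f \<in> F" "card f = 3"
    and I: "\<And>i j k. f = {i, j, k} \<Longrightarrow> distinct [i, j, k] \<Longrightarrow> compatible_weights (I {j, k}) (I {i, k}) (I {i, j})"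
    and r: "\<And>v. v \<in> f \<Longrightarrow> 0 < r v" "strict_triangle_inequalities F (hyperbolic_length I r)"
    and r': "\<And>v. v \<in> f \<Longrightarrow> 0 < r' v" "strict_triangle_inequalities F (hyperbolic_length I r')"
  defines "D \<equiv> \<Sum>v\<in>f. (ln (tanh (r' v / 2)) - ln (tanh (r v / 2))) *
      (hyperbolic_inner_angle (hyperbolic_length I r') v f - hyperbolic_inner_angle (hyperbolic_length
          I r) v f)"
  shows "D \<le> 0" and "D = 0 \<Longrightarrow> v \<in> f \<Longrightarrow> r' v = r v"
proof -
  obtain i j k where ijk: "f = {i, j, k}" "i \<noteq> j" "i \<noteq> k" "j \<noteq> k"
    using f(2) by (auto simp: card_3_iff)
  have perm: "f = {i, j, k}" "distinct [i, j, k]" "f = {j, i, k}" "distinct [j, i, k]" "f = {k, i, j}"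
      "distinct [k, i, j]"
    using ijk by auto
  have adm: "compatible_weights (I {j, k}) (I {i, k}) (I {i, j})" using I[OF perm(1,2)] .
  then have Igt: "-1 < I {i, j}" "-1 < I {i, k}" "-1 < I {j, k}" unfolding compatible_weights_def by auto
  define x where "x = (\<lambda>v. ln (tanh (r' v / 2)) - ln (tanh (r v / 2)))"
  define L where "L = (\<lambda>r a b. cosh_length (I {a, b}) (r a) (r b))"
  have Lsym: "L r a b = L r b a" for r a b
    unfolding L_def by (simp add: insert_commute cosh_length_commute)
  have pos: "0 < r i" "0 < r j" "0 < r k" "0 < r' i" "0 < r' j" "0 < r' k" using r(1) r'(1) ijk(1) by auto
  have ang: "hyperbolic_inner_angle (hyperbolic_length I q) i f
      = hyperbolic_corner (L q j k) (L q i k) (L q i j)"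
    "hyperbolic_inner_angle (hyperbolic_length I q) j f = hyperbolic_corner (L q i k) (L q j k) (L q i j)"
    "hyperbolic_inner_angle (hyperbolic_length I q) k f = hyperbolic_corner (L q i j) (L q j k) (L q i k)"
    and gram: "gram_det (L q j k) (L q i k) (L q i j) > 0"
    if q: "0 < q i" "0 < q j" "0 < q k" "strict_triangle_inequalities F (hyperbolic_length I q)" for q
  proof -
    note I' = Igt Igt[unfolded insert_commute[of i j] insert_commute[of i k] insert_commute[of j k]]
    show "hyperbolic_inner_angle (hyperbolic_length I q) i f = hyperbolic_corner (L q j k) (L q i k) (L
        q i j)"
      "gram_det (L q j k) (L q i k) (L q i j) > 0"
      unfolding L_def using hyperbolic_packing_inner_angle[OF perm(1,2) _ _ _ _ _ _ q(4) f(1)] q Igt by auto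
    show "hyperbolic_inner_angle (hyperbolic_length I q) j f = hyperbolic_corner (L q i k) (L q j k) (L
        q i j)"
      using hyperbolic_packing_inner_angle(1)[OF perm(3,4) _ _ _ _ _ _ q(4) f(1)] q I'
      unfolding Lsym[of q i j] unfolding L_def by auto
    show "hyperbolic_inner_angle (hyperbolic_length I q) k f = hyperbolic_corner (L q i j) (L q j k) (L
        q i k)"
      using hyperbolic_packing_inner_angle(1)[OF perm(5,6) _ _ _ _ _ _ q(4) f(1)] q I'
      unfolding Lsym[of q j k] Lsym[of q i k] unfolding L_def by auto
  qed
  note ang_r = ang[OF pos(1-3) r(2)] and ang_r' = ang[OF pos(4-6) r'(2)]
  have D: "D = (x i * hyperbolic_corner (L r' j k) (L r' i k) (L r' i j)
      + x j * hyperbolic_corner (L r' i k) (L r' j k) (L r' i j)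
      + x k * hyperbolic_corner (L r' i j) (L r' j k) (L r' i k))
    - (x i * hyperbolic_corner (L r j k) (L r i k) (L r i j) + x j * hyperbolic_corner (L r i k) (L r j
        k) (L r i j)
      + x k * hyperbolic_corner (L r i j) (L r j k) (L r i k))"
    unfolding D_def x_def ang_r[symmetric] ang_r'[symmetric] using ijk(2-4)
    by (simp add: ijk(1) algebra_simps)
  have strict: "D < 0" if "\<not> (x i = 0 \<and> x j = 0 \<and> x k = 0)"
    using hyperbolic_triangle_strict_monotone[OF adm pos gram[OF pos(1-3) r(2), unfolded L_def]
        that[unfolded x_def]]
    unfolding D x_def L_def by simp
  show "D \<le> 0"
    using strict unfolding D by (cases "x i = 0 \<and> x j = 0 \<and> x k = 0") auto
  show "r' v = r v" if "D = 0" "v \<in> f"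
  proof -
    have "x v = 0" using strict that ijk(1) by auto
    then have "tanh (r' v / 2) = tanh (r v / 2)" using r(1) r'(1) that(2) unfolding x_def by simp
    then show ?thesis by simp
  qed
qed

section \<open>From faces to the closed surface\<close>

lemma constant_on_faces_imp_constant:
  fixes x :: "'v \<Rightarrow> 'b"
  assumes "closed_surface M" and tri: "surface_triangulation M V E F"
    and const: "\<And>f v w. f \<in> F \<Longrightarrow> v \<in> f \<Longrightarrow> w \<in> f \<Longrightarrow> x v = x w"
    and a: "a \<in> V" and b: "b \<in> V"
  shows "x a = x b"
proof (rule ccontr)
  assume ne: "x a \<noteq> x b"
  define X where "X = geometric_realization V F"
  have F: "finite F" "\<And>f. f \<in> F \<Longrightarrow> card f = 3" "V = \<Union>F" and hom: "X homeomorphic_space M"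
    using tri unfolding surface_triangulation_def X_def by auto
  have "finite f" if "f \<in> F" for f using F(2)[OF that] by (metis card.infinite zero_neq_numeral)
  then have "finite V" using F by auto
  have conn: "connected_space X"
    using hom assms(1) homeomorphic_connected_space unfolding closed_surface_def by blast
  \<comment> \<open>The total weight of the vertices on which \<open>x\<close> has the value \<open>x a\<close>. The support of a point lies in a
      face, on which \<open>x\<close> is constant, so this continuous function only takes the values 0 and 1; it is
      1 at the vertex \<open>a\<close> and 0 at the vertex \<open>b\<close>.\<close>
  define \<phi> where "\<phi> = (\<lambda>y :: 'v \<Rightarrow> real. \<Sum>v\<in>{v\<in>V. x v = x a}. y v)"
  have cont: "continuous_map X euclideanreal \<phi>"
    unfolding X_def geometric_realization_def \<phi>_def
    by (intro continuous_map_from_subtopology continuous_map_sum continuous_map_product_projection)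
       (use \<open>finite V\<close> in auto)
  have top: "y \<in> topspace X \<longleftrightarrow> y \<in> extensional V \<and> (\<forall>v\<in>V. 0 \<le> y v) \<and> (\<Sum>v\<in>V. y v)
      = 1 \<and> (\<exists>f\<in>F. {v\<in>V. y v \<noteq> 0} \<subseteq> f)" for y
    unfolding X_def geometric_realization_def by (simp add: PiE_UNIV_domain PiE_def)
  have vals: "\<phi> y \<in> {0, 1}" if y: "y \<in> topspace X" for y
  proof -
    obtain f where f: "f \<in> F" "{v\<in>V. y v \<noteq> 0} \<subseteq> f" and sum1: "(\<Sum>v\<in>V. y v) = 1" using y top by blast
    show ?thesis
    proof (cases "\<exists>v\<in>f. x v = x a")
      case True
      then have "x v = x a" if "v \<in> f" for v using const f(1) that by metis
      then have "\<phi> y = (\<Sum>v\<in>V. y v)"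
        unfolding \<phi>_def using f(2) \<open>finite V\<close> by (intro sum.mono_neutral_left) auto
      then show ?thesis using sum1 by simp
    next
      case False
      then have "\<phi> y = 0" unfolding \<phi>_def using f(2) by (intro sum.neutral) auto
      then show ?thesis by simp
    qed
  qed
  define \<delta> where "\<delta> = (\<lambda>c. \<lambda>v\<in>V. if v = c then 1 else 0 :: real)"
  have delta: "\<delta> c \<in> topspace X" if c: "c \<in> V" for c
  proof -
    obtain f where "f \<in> F" "c \<in> f" using c F(3) by blast
    moreover have "(\<Sum>v\<in>V. \<delta> c v) = 1" unfolding \<delta>_def using c \<open>finite V\<close> by simp
    ultimately show ?thesis unfolding top \<delta>_def by (auto split: if_splits)
  qed
  have "\<phi> (\<delta> a) = 1" unfolding \<phi>_def \<delta>_def using a \<open>finite V\<close> by simp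
  moreover have "\<phi> (\<delta> b) = 0" unfolding \<phi>_def \<delta>_def using ne by (intro sum.neutral) auto
  ultimately have "0 \<in> \<phi> ` topspace X" "1 \<in> \<phi> ` topspace X" using delta a b by (metis image_eqI)+
  moreover have "connected (\<phi> ` topspace X)"
    using connectedin_continuous_map_image[OF cont] conn connectedin_topspace
        by (metis connectedin_iff_connected)
  ultimately have "1/2 \<in> \<phi> ` topspace X"
    using connectedD_interval[of "\<phi> ` topspace X" 0 1 "1/2"] by auto
  then show False using vals by force
qed

text \<open>Summation over incident pairs of a vertex and a face, in both orders.\<close>

lemma vertex_sum_eq_face_sum:
  fixes \<theta> \<theta>' :: "'v \<Rightarrow> 'v set \<Rightarrow> real"
  assumes "finite F" "\<And>f. f \<in> F \<Longrightarrow> finite f"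
  shows "(\<Sum>v\<in>\<Union>F. x v * ((2 * pi - (\<Sum>f | f \<in> F \<and> v \<in> f. \<theta>' v f)) - (2 * pi - (\<Sum>f | f \<in> F \<and> v \<in> f. \<theta> v f))))
     = - (\<Sum>f\<in>F. \<Sum>v\<in>f. x v * (\<theta>' v f - \<theta> v f))"
proof -
  have fin: "finite (\<Union>F)" using assms by auto
  have "(\<Sum>v\<in>\<Union>F. x v * ((2 * pi - (\<Sum>f | f \<in> F \<and> v \<in> f. \<theta>' v f)) - (2 * pi - (\<Sum>f | f \<in> F \<and> v \<in> f. \<theta> v f))))
     = - (\<Sum>v\<in>\<Union>F. \<Sum>f | f \<in> F \<and> v \<in> f. x v * (\<theta>' v f - \<theta> v f))"
    unfolding sum_negf[symmetric]
    by (intro sum.cong refl) (simp add: sum_subtractf sum_distrib_left[symmetric] algebra_simps)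
  also have "(\<Sum>v\<in>\<Union>F. \<Sum>f | f \<in> F \<and> v \<in> f. x v * (\<theta>' v f - \<theta> v f))
     = (\<Sum>f\<in>F. \<Sum>v | v \<in> \<Union>F \<and> v \<in> f. x v * (\<theta>' v f - \<theta> v f))"
    using sum.swap_restrict[OF fin assms(1), of "\<lambda>v f. x v * (\<theta>' v f - \<theta> v f)" "\<lambda>v f. v \<in> f"] .
  also have "\<dots> = (\<Sum>f\<in>F. \<Sum>v\<in>f. x v * (\<theta>' v f - \<theta> v f))"
    by (intro sum.cong refl) auto
  finally show ?thesis .
qed

text \<open>\<open>R exp (\<alpha> u)\<close> is nonincreasing in \<open>u\<close>, and strictly decreasing if \<open>\<alpha> * R \<noteq> 0\<close>. Multiplying by \<open>\<alpha>\<^sup>2\<close>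
  reduces this to the monotonicity of \<open>exp\<close> in \<open>\<alpha> u\<close>.\<close>

lemma curvature_difference_sign:
  fixes \<alpha> R s s' :: real
  assumes "\<alpha> * R \<le> 0" "s > 0" "s' > 0"
  shows "(ln s' - ln s) * (R * s' powr \<alpha> - R * s powr \<alpha>) \<le> 0"
    and "(ln s' - ln s) * (R * s' powr \<alpha> - R * s powr \<alpha>) = 0 \<Longrightarrow> \<alpha> * R \<noteq> 0 \<Longrightarrow> s' = s"
proof -
  define p q where "p = \<alpha> * ln s" and "q = \<alpha> * ln s'"
  have mono: "(q - p) * (exp q - exp p) \<ge> 0"
    by (cases p q rule: linorder_cases) (auto intro: mult_nonneg_nonneg mult_nonpos_nonpos)
  have eq: "\<alpha>\<^sup>2 * ((ln s' - ln s) * (R * s' powr \<alpha> - R * s powr \<alpha>)) = (\<alpha> * R) * ((q - p) * (exp q - exp p))"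
    using assms(2,3) by (simp add: p_def q_def powr_def algebra_simps power2_eq_square)
  show "(ln s' - ln s) * (R * s' powr \<alpha> - R * s powr \<alpha>) \<le> 0"
  proof (cases "\<alpha> = 0")
    case False
    have "\<alpha>\<^sup>2 * ((ln s' - ln s) * (R * s' powr \<alpha> - R * s powr \<alpha>)) \<le> 0"
      unfolding eq using mono assms(1) by (rule mult_nonpos_nonneg[rotated])
    with False show ?thesis by (simp add: mult_le_0_iff)
  qed (use assms in simp)
  assume "(ln s' - ln s) * (R * s' powr \<alpha> - R * s powr \<alpha>) = 0" "\<alpha> * R \<noteq> 0"
  with eq have "(q - p) * (exp q - exp p) = 0" by auto
  then have "q = p" by auto
  then show "s' = s" using \<open>\<alpha> * R \<noteq> 0\<close> assms(2,3) unfolding p_def q_def by simp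
qed

text \<open>The sum of the vertex terms is minus the sum of the face terms, and all of them are
  nonpositive; so each of them is zero.\<close>

lemma equality_in_curvature_comparison:
  fixes s s' :: "'v \<Rightarrow> real" and \<theta> \<theta>' :: "'v \<Rightarrow> 'v set \<Rightarrow> real"
  assumes F: "finite F" "\<And>f. f \<in> F \<Longrightarrow> finite f" and V: "V = \<Union>F"
    and s: "\<And>v. v \<in> V \<Longrightarrow> s v > 0" "\<And>v. v \<in> V \<Longrightarrow> s' v > 0"
    and face: "\<And>f. f \<in> F \<Longrightarrow> (\<Sum>v\<in>f. (ln (s' v) - ln (s v)) * (\<theta>' v f - \<theta> v f)) \<le> 0"
    and sign: "\<And>v. v \<in> V \<Longrightarrow> \<alpha> * R v \<le> 0"
    and curv: "\<And>v. v \<in> V \<Longrightarrow> (2 * pi - (\<Sum>f | f \<in> F \<and> v \<in> f. \<theta> v f)) / s v powr \<alpha> = R v"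
    and curv': "\<And>v. v \<in> V \<Longrightarrow> (2 * pi - (\<Sum>f | f \<in> F \<and> v \<in> f. \<theta>' v f)) / s' v powr \<alpha> = R v"
  shows "\<And>f. f \<in> F \<Longrightarrow> (\<Sum>v\<in>f. (ln (s' v) - ln (s v)) * (\<theta>' v f - \<theta> v f)) = 0"
    and "\<And>v. v \<in> V \<Longrightarrow> \<alpha> * R v \<noteq> 0 \<Longrightarrow> s' v = s v"
proof -
  have finV: "finite V" using F V by auto
  define d where "d = (\<lambda>v. (ln (s' v) - ln (s v)) * (R v * s' v powr \<alpha> - R v * s v powr \<alpha>))"
  define D where "D = (\<lambda>f. \<Sum>v\<in>f. (ln (s' v) - ln (s v)) * (\<theta>' v f - \<theta> v f))"
  have K: "2 * pi - (\<Sum>f | f \<in> F \<and> v \<in> f. \<theta> v f) = R v * s v powr \<alpha>"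
    "2 * pi - (\<Sum>f | f \<in> F \<and> v \<in> f. \<theta>' v f) = R v * s' v powr \<alpha>" if "v \<in> V" for v
    using curv[OF that] curv'[OF that] s[OF that] by (auto simp: field_simps)
  have "(\<Sum>v\<in>V. d v) = (\<Sum>v\<in>V. (ln (s' v) - ln (s v)) * ((2 * pi - (\<Sum>f | f \<in> F \<and> v \<in> f. \<theta>' v f)) - (2 *
      pi - (\<Sum>f | f \<in> F \<and> v \<in> f. \<theta> v f))))"
    unfolding d_def by (intro sum.cong refl) (simp only: K)
  also have "\<dots> = - (\<Sum>f\<in>F. D f)" unfolding V D_def by (rule vertex_sum_eq_face_sum[OF F])
  finally have eq: "(\<Sum>v\<in>V. d v) + (\<Sum>f\<in>F. D f) = 0" by simp
  have d: "d v \<le> 0" if "v \<in> V" for v unfolding d_def using curvature_difference_sign(1) sign s that by blast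
  have D: "D f \<le> 0" if "f \<in> F" for f unfolding D_def using face that .
  have "(\<Sum>v\<in>V. d v) \<le> 0" "(\<Sum>f\<in>F. D f) \<le> 0" using d D by (auto intro: sum_nonpos)
  with eq have "(\<Sum>v\<in>V. d v) = 0" "(\<Sum>f\<in>F. D f) = 0" by linarith+
  then have zero: "\<And>v. v \<in> V \<Longrightarrow> d v = 0" "\<And>f. f \<in> F \<Longrightarrow> D f = 0"
    using sum_nonneg_eq_0_iff[OF finV, of "\<lambda>v. - d v"] sum_nonneg_eq_0_iff[OF F(1), of "\<lambda>f. - D f"] d D
    by (simp_all add: sum_negf)
  show "\<And>f. f \<in> F \<Longrightarrow> (\<Sum>v\<in>f. (ln (s' v) - ln (s v)) * (\<theta>' v f - \<theta> v f)) = 0"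
    using zero(2) unfolding D_def .
  show "s' v = s v" if "v \<in> V" "\<alpha> * R v \<noteq> 0" for v
    using zero(1)[OF that(1)] curvature_difference_sign(2)[OF sign[OF that(1)] s[OF that(1)] _ that(2)]
        unfolding d_def by blast
qed

lemma edges_of_face:
  assumes "f \<in> F" "f = {i, j, k}" "distinct [i, j, k]" "E = {e. card e = 2 \<and> (\<exists>f\<in>F. e \<subseteq> f)}"
  shows "{i, j} \<in> E" "{i, k} \<in> E" "{j, k} \<in> E"
proof -
  have "card {i, j} = 2" "card {i, k} = 2" "card {j, k} = 2" using assms(3) by simp_all
  moreover have "{i, j} \<subseteq> f" "{i, k} \<subseteq> f" "{j, k} \<subseteq> f" using assms(2) by blast+
  ultimately show "{i, j} \<in> E" "{i, k} \<in> E" "{j, k} \<in> E" unfolding assms(4) using assms(1) by blast+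
qed

theorem theorem1p2:
  fixes M :: "'m topology"
    and V :: "'v set" and E F :: "'v set set"
    and I :: "'v set \<Rightarrow> real"
    and \<alpha> :: real and Rbar :: "'v \<Rightarrow> real"
  assumes "closed_surface M"
    and "surface_triangulation M V E F"
    and "\<forall>e\<in>E. -1 < I e"
    and "\<forall>i j k. {i, j, k} \<in> F \<longrightarrow>
           I {i, j} + I {i, k} * I {j, k} \<ge> 0 \<and>
           I {i, k} + I {i, j} * I {j, k} \<ge> 0 \<and>
           I {j, k} + I {i, j} * I {i, k} \<ge> 0"
  shows
    "((\<forall>i\<in>V. \<alpha> * Rbar i = 0) \<longrightarrow>
        (\<forall>r r'. euclidean_packing_metric V F I r \<and>
                (\<forall>i\<in>V. euclidean_alpha_curvature F I \<alpha> r i = Rbar i) \<and>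
                euclidean_packing_metric V F I r' \<and>
                (\<forall>i\<in>V. euclidean_alpha_curvature F I \<alpha> r' i = Rbar i) \<longrightarrow>
                (\<exists>c>0. \<forall>i\<in>V. r' i = c * r i)))
     \<and> ((\<forall>i\<in>V. \<alpha> * Rbar i \<le> 0) \<and> \<not> (\<forall>i\<in>V. \<alpha> * Rbar i = 0) \<longrightarrow>
        (\<forall>r r'. euclidean_packing_metric V F I r \<and>
                (\<forall>i\<in>V. euclidean_alpha_curvature F I \<alpha> r i = Rbar i) \<and>
                euclidean_packing_metric V F I r' \<and>
                (\<forall>i\<in>V. euclidean_alpha_curvature F I \<alpha> r' i = Rbar i) \<longrightarrow>
                (\<forall>i\<in>V. r' i = r i)))
     \<and> ((\<forall>i\<in>V. \<alpha> * Rbar i \<le> 0) \<longrightarrow>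
        (\<forall>r r'. hyperbolic_packing_metric V F I r \<and>
                (\<forall>i\<in>V. hyperbolic_alpha_curvature F I \<alpha> r i = Rbar i) \<and>
                hyperbolic_packing_metric V F I r' \<and>
                (\<forall>i\<in>V. hyperbolic_alpha_curvature F I \<alpha> r' i = Rbar i) \<longrightarrow>
                (\<forall>i\<in>V. r' i = r i)))"
proof -
  have F: "finite F" "\<And>f. f \<in> F \<Longrightarrow> card f = 3" and V: "V = \<Union>F"
    and E: "E = {e. card e = 2 \<and> (\<exists>f\<in>F. e \<subseteq> f)}"
    using assms(2) unfolding surface_triangulation_def by auto
  have finf: "finite f" if "f \<in> F" for f using F(2)[OF that] by (metis card.infinite zero_neq_numeral)
  have fV: "v \<in> V" if "f \<in> F" "v \<in> f" for f v using that V by auto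
  have compatible: "compatible_weights (I {j, k}) (I {i, k}) (I {i, j})"
    if f: "f \<in> F" "f = {i, j, k}" "distinct [i, j, k]" for f i j k
    using edges_of_face[OF f E] assms(3,4) f unfolding compatible_weights_def
    by (auto simp: mult.commute)
  have euclidean: "\<exists>c>0. (\<forall>i\<in>V. r' i = c * r i) \<and> ((\<exists>i\<in>V. \<alpha> * Rbar i \<noteq> 0) \<longrightarrow> c = 1)"
    if sign: "\<forall>i\<in>V. \<alpha> * Rbar i \<le> 0"
      and r: "euclidean_packing_metric V F I r" "\<forall>i\<in>V. euclidean_alpha_curvature F I \<alpha> r i = Rbar i"
      and r': "euclidean_packing_metric V F I r'" "\<forall>i\<in>V. euclidean_alpha_curvature F I \<alpha> r' i
          = Rbar i" for r r'
  proof -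
    have pos: "\<And>v. v \<in> V \<Longrightarrow> r v > 0" "\<And>v. v \<in> V \<Longrightarrow> r' v > 0"
      and tri: "strict_triangle_inequalities F (euclidean_length I r)"
          "strict_triangle_inequalities F (euclidean_length I r')"
      using r(1) r'(1) unfolding euclidean_packing_metric_def by auto
    define x where "x = (\<lambda>v. ln (r' v) - ln (r v))"
    define \<theta> where "\<theta> = (\<lambda>r. euclidean_inner_angle (euclidean_length I r))"
    define D where "D = (\<lambda>f. \<Sum>v\<in>f. (ln (r' v) - ln (r v)) * (\<theta> r' v f - \<theta> r v f))"
    have face: "D f \<le> 0" "D f = 0 \<Longrightarrow> v \<in> f \<Longrightarrow> w \<in> f \<Longrightarrow> x v = x w" if f: "f \<in> F" for f v w
      unfolding D_def \<theta>_def x_def using f pos fV tri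
      by (intro euclidean_face_comparison[of f F I r r'] compatible[of f] F(2); blast)+
    have curv: "(2 * pi - (\<Sum>f | f \<in> F \<and> v \<in> f. \<theta> r v f)) / r v powr \<alpha> = Rbar v"
      "(2 * pi - (\<Sum>f | f \<in> F \<and> v \<in> f. \<theta> r' v f)) / r' v powr \<alpha> = Rbar v" if "v \<in> V" for v
      using r(2) r'(2) that unfolding euclidean_alpha_curvature_def euclidean_curvature_def \<theta>_def by auto
    have eq: "D f = 0" if "f \<in> F" for f
      unfolding D_def
      by (rule equality_in_curvature_comparison(1)[where F = F and V = V and s = "r" and s' = "r'"
          and \<theta> = "\<theta> r" and
          \<theta>' = "\<theta> r'" and \<alpha> = \<alpha> and R = Rbar])
        (use F(1) finf V pos face(1)[unfolded D_def] sign curv that in blast)+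
    have eq': "r' v = r v" if "v \<in> V" "\<alpha> * Rbar v \<noteq> 0" for v
      by (rule equality_in_curvature_comparison(2)[where F = F and V = V and s = "r" and s' = "r'"
          and \<theta> = "\<theta> r" and
          \<theta>' = "\<theta> r'" and \<alpha> = \<alpha> and R = Rbar])
        (use F(1) finf V pos face(1)[unfolded D_def] sign curv that in blast)+
    have "x v = x w" if "f \<in> F" "v \<in> f" "w \<in> f" for f v w
      using face(2) eq that by blast
    then have const: "x v = x w" if "v \<in> V" "w \<in> V" for v w
      using constant_on_faces_imp_constant[OF assms(1,2), of x] that by blast
    have r'_eq: "r' v = exp (x v) * r v" if "v \<in> V" for v
      unfolding x_def using pos(1)[OF that] pos(2)[OF that] by (simp add: exp_diff)
    show ?thesis
    proof (cases "\<exists>i\<in>V. \<alpha> * Rbar i \<noteq> 0")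
      case True
      then obtain i where i: "i \<in> V" "\<alpha> * Rbar i \<noteq> 0" by blast
      then have "r' i = r i" using eq' by blast
      then have "x i = 0" unfolding x_def by simp
      then have "r' v = 1 * r v" if "v \<in> V" for v using r'_eq[OF that] const[OF that i(1)] by simp
      then show ?thesis by (intro exI[of _ 1]) simp
    next
      case False
      show ?thesis
      proof (cases "V = {}")
        case True
        then show ?thesis by (intro exI[of _ 1]) simp
      next
        case nonempty: False
        then obtain i where "i \<in> V" by blast
        then have "r' v = exp (x i) * r v" if "v \<in> V" for v using r'_eq const that by metis
        with False show ?thesis by (intro exI[of _ "exp (x i)"] conjI exp_gt_zero) blast+
      qed
    qed
  qed
  have hyperbolic: "r' i = r i"
    if sign: "\<forall>i\<in>V. \<alpha> * Rbar i \<le> 0"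
      and r: "hyperbolic_packing_metric V F I r" "\<forall>i\<in>V. hyperbolic_alpha_curvature F I \<alpha> r i = Rbar i"
      and r': "hyperbolic_packing_metric V F I r'" "\<forall>i\<in>V. hyperbolic_alpha_curvature F I \<alpha> r' i = Rbar i"
      and i: "i \<in> V" for r r' i
  proof -
    have pos: "\<And>v. v \<in> V \<Longrightarrow> r v > 0" "\<And>v. v \<in> V \<Longrightarrow> r' v > 0"
      and tri: "strict_triangle_inequalities F (hyperbolic_length I r)"
          "strict_triangle_inequalities F (hyperbolic_length I r')"
      using r(1) r'(1) unfolding hyperbolic_packing_metric_def by auto
    have tanh_pos: "\<And>v. v \<in> V \<Longrightarrow> tanh (r v / 2) > 0" "\<And>v. v \<in> V \<Longrightarrow> tanh (r' v / 2) > 0"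
      using pos by simp_all
    define \<theta> where "\<theta> = (\<lambda>r. hyperbolic_inner_angle (hyperbolic_length I r))"
    define D where "D = (\<lambda>f. \<Sum>v\<in>f. (ln (tanh (r' v / 2)) - ln (tanh (r v / 2))) * (\<theta> r' v f - \<theta> r v f))"
    have face: "D f \<le> 0" "D f = 0 \<Longrightarrow> v \<in> f \<Longrightarrow> r' v = r v" if f: "f \<in> F" for f v
      unfolding D_def \<theta>_def using f pos fV tri
      by (intro hyperbolic_face_comparison[of f F I r r'] compatible[of f] F(2); blast)+
    have curv: "(2 * pi - (\<Sum>f | f \<in> F \<and> v \<in> f. \<theta> r v f)) / tanh (r v / 2) powr \<alpha> = Rbar v"
      "(2 * pi - (\<Sum>f | f \<in> F \<and> v \<in> f. \<theta> r' v f)) / tanh (r' v / 2) powr \<alpha> = Rbar v" if "v \<in> V" for v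
      using r(2) r'(2) that unfolding hyperbolic_alpha_curvature_def hyperbolic_curvature_def \<theta>_def by auto
    have eq: "D f = 0" if "f \<in> F" for f
      unfolding D_def
      by (rule equality_in_curvature_comparison(1)[where F = F and V = V and s =
          "\<lambda>v. tanh (r v / 2)" and s' = "\<lambda>v. tanh (r' v / 2)" and \<theta> = "\<theta> r" and
          \<theta>' = "\<theta> r'" and \<alpha> = \<alpha> and R = Rbar])
        (use F(1) finf V tanh_pos face(1)[unfolded D_def] sign curv that in blast)+
    obtain f where "f \<in> F" "i \<in> f" using i V by auto
    then show ?thesis using face(2) eq by blast
  qed
  show ?thesis
  proof (intro conjI impI allI ballI; (elim conjE)?)
    fix r r'
    assume "\<forall>i\<in>V. \<alpha> * Rbar i = 0" "euclidean_packing_metric V F I r"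
        "\<forall>i\<in>V. euclidean_alpha_curvature F I \<alpha> r i = Rbar i"
      "euclidean_packing_metric V F I r'" "\<forall>i\<in>V. euclidean_alpha_curvature F I \<alpha> r' i = Rbar i"
    then show "\<exists>c>0. \<forall>i\<in>V. r' i = c * r i" using euclidean[of r r'] by auto
  next
    fix r r' i
    assume "\<forall>i\<in>V. \<alpha> * Rbar i \<le> 0" "\<not> (\<forall>i\<in>V. \<alpha> * Rbar i = 0)" "euclidean_packing_metric V F I r"
        "\<forall>i\<in>V. euclidean_alpha_curvature F I \<alpha> r i = Rbar i"
      "euclidean_packing_metric V F I r'" "\<forall>i\<in>V. euclidean_alpha_curvature F I \<alpha> r' i = Rbar i" "i \<in> V"
    then show "r' i = r i" using euclidean[of r r'] by auto
  next
    fix r r' i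
    assume "\<forall>i\<in>V. \<alpha> * Rbar i \<le> 0" "hyperbolic_packing_metric V F I r"
        "\<forall>i\<in>V. hyperbolic_alpha_curvature F I \<alpha> r i = Rbar i"
      "hyperbolic_packing_metric V F I r'" "\<forall>i\<in>V. hyperbolic_alpha_curvature F I \<alpha> r' i = Rbar i" "i \<in> V"
    then show "r' i = r i" using hyperbolic[of r r' i] by blast
  qed
qed

end
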